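(* Let $\mathbf{k}$ be a field. Every standard object of $\mathcal{A}$ is an injective object of $\mathcal{A}$.
   Context: Let $\mathfrak{S}=\bigcup_{n\ge1}\mathfrak{S}_n$ be the infinite symmetric group (finitary permutations of $\{1,2,\ldots\}$), and $\mathfrak{S}^n\subset\mathfrak{S}$ the subgroup fixing each of $1,\ldots,n$. Let $\mathbf{K}=\mathbf{k}(\xi_1,\xi_2,\ldots)$, on which $\mathfrak{S}$ acts by permuting variables. $\mathcal{A}$ is the category of smooth $\mathbf{K}$-semilinear representations of $\mathfrak{S}$: $\mathbf{K}$-vector spaces $M$ with an additive action of $\mathfrak{S}$ satisfying $\sigma(av)=(\sigma a)(\sigma v)$, such that every $v\in M$ is fixed by $\mathfrak{S}^n$ for some $n$. Morphisms are $\mathbf{K}$-linear $\mathfrak{S}$-equivariant maps. $\mathbf{I}^r=\mathbf{K}\otimes_{\mathbf{k}}\mathbf{V}^r$, where $\mathbf{V}^r$ is the $\mathbf{k}$-vector space with basis $\{e_S\}$ indexed by the $r$-element subsets $S$ of $\{1,2,\ldots\}$, permuted by $\mathfrak{S}$. An object of $\mathcal{A}$ is standard if it is isomorphic to a (possibly infinite) direct sum of objects of the form $\mathbf{I}^r$ ($r\ge0$ allowed to vary). *)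

theory Defs
  imports
    "HOL.Vector_Spaces"
    "HOL-Library.Poly_Mapping"
    "HOL-Computational_Algebra.Fraction_Field"
    "HOL-Combinatorics.Perm"
begin

unbundle permutation_syntax

text \<open>
  The type \<^typ>\<open>nat perm\<close> of finitary permutations is the infinite symmetric group.
  The index set \<open>{1, 2, \<dots>}\<close> is relabelled as \<open>{0, 1, \<dots>}\<close>, so that the subgroup
  fixing the first \<open>n\<close> indices is the following.
\<close>

definition fixing :: "nat \<Rightarrow> nat perm set" where
  "fixing n = {\<sigma>. \<forall>i<n. \<sigma> \<langle>$\<rangle> i = i}"


section \<open>The field of rational functions in infinitely many variables\<close>

text \<open>
  A monomial is a finitely supported exponent vector \<^typ>\<open>nat \<Rightarrow>\<^sub>0 nat\<close>, a polynomial a finitely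
  supported function from monomials to coefficients.
\<close>

type_synonym 'k ratfun = "((nat \<Rightarrow>\<^sub>0 nat) \<Rightarrow>\<^sub>0 'k) fract"

text \<open>
  A permutation \<open>\<sigma>\<close> sends the \<open>i\<close>-th variable to the \<open>\<sigma> i\<close>-th one. Since
  \<^const>\<open>Poly_Mapping.map_key\<close> is precomposition, the inverse permutation enters.
\<close>

definition permute_mon :: "nat perm \<Rightarrow> (nat \<Rightarrow>\<^sub>0 nat) \<Rightarrow> (nat \<Rightarrow>\<^sub>0 nat)" where
  "permute_mon \<sigma> = Poly_Mapping.map_key (apply (inverse \<sigma>))"

definition permute_poly ::
    "nat perm \<Rightarrow> ((nat \<Rightarrow>\<^sub>0 nat) \<Rightarrow>\<^sub>0 'k) \<Rightarrow> ((nat \<Rightarrow>\<^sub>0 nat) \<Rightarrow>\<^sub>0 'k::field)" where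
  "permute_poly \<sigma> = Poly_Mapping.map_key (permute_mon (inverse \<sigma>))"

lemma apply_inverse_apply [simp]:
  "inverse \<sigma> \<langle>$\<rangle> (\<sigma> \<langle>$\<rangle> i) = i" "\<sigma> \<langle>$\<rangle> (inverse \<sigma> \<langle>$\<rangle> i) = i"
  by (simp_all add: apply_sequence)

lemma inj_apply [simp]: "inj (apply \<sigma>)"
  by (simp add: bij_is_inj)

lemma inj_image_apply [simp]: "inj ((`) (apply \<sigma>))"
  by (rule injI) (simp add: inj_image_eq_iff)

lemma lookup_permute_mon [simp]:
  "Poly_Mapping.lookup (permute_mon \<sigma> m) i = Poly_Mapping.lookup m (inverse \<sigma> \<langle>$\<rangle> i)"
  by (simp add: permute_mon_def map_key.rep_eq)

lemma permute_mon_one [simp]: "permute_mon 1 m = m"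
  by (rule poly_mapping_eqI) simp

lemma permute_mon_mult: "permute_mon (\<sigma> * \<tau>) m = permute_mon \<sigma> (permute_mon \<tau> m)"
  by (rule poly_mapping_eqI) (simp add: apply_times)

lemma permute_mon_inverse [simp]:
  "permute_mon (inverse \<sigma>) (permute_mon \<sigma> m) = m"
  "permute_mon \<sigma> (permute_mon (inverse \<sigma>) m) = m"
  by (simp_all flip: permute_mon_mult)

lemma permute_mon_add: "permute_mon \<sigma> (m + m') = permute_mon \<sigma> m + permute_mon \<sigma> m'"
  by (rule poly_mapping_eqI) (simp add: lookup_add)

lemma inj_permute_mon [simp]: "inj (permute_mon \<sigma>)"
  by (metis injI permute_mon_inverse(1))

lemma lookup_permute_poly [simp]:
  "Poly_Mapping.lookup (permute_poly \<sigma> p) m = Poly_Mapping.lookup p (permute_mon (inverse \<sigma>) m)"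
  by (simp add: permute_poly_def map_key.rep_eq)

lemma permute_poly_one [simp]: "permute_poly 1 p = p"
  by (rule poly_mapping_eqI) simp

lemma permute_poly_compose: "permute_poly (\<sigma> * \<tau>) p = permute_poly \<sigma> (permute_poly \<tau> p)"
  by (rule poly_mapping_eqI) (simp add: permute_mon_mult)

lemma permute_poly_inverse [simp]:
  "permute_poly (inverse \<sigma>) (permute_poly \<sigma> p) = p"
  by (simp flip: permute_poly_compose)

lemma permute_poly_zero [simp]: "permute_poly \<sigma> 0 = 0"
  by (rule poly_mapping_eqI) simp

lemma permute_poly_eq_0_iff [simp]: "permute_poly \<sigma> p = 0 \<longleftrightarrow> p = 0"
  by (metis permute_poly_inverse permute_poly_zero)

lemma permute_poly_add: "permute_poly \<sigma> (p + q) = permute_poly \<sigma> p + permute_poly \<sigma> q"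
  by (rule poly_mapping_eqI) (simp add: lookup_add)

lemma permute_poly_single:
  "permute_poly \<sigma> (Poly_Mapping.single m c) = Poly_Mapping.single (permute_mon \<sigma> m) c"
  by (rule poly_mapping_eqI) (metis lookup_permute_poly lookup_single_eq lookup_single_not_eq
      permute_mon_inverse)

lemma single_add_induct:
  assumes "P 0" "\<And>a b p. P p \<Longrightarrow> P (Poly_Mapping.single a b + p)"
  shows "P (p :: 'a \<Rightarrow>\<^sub>0 'b::monoid_add)"
proof (induction p rule: update_induct)
  case const
  then show ?case by (rule assms)
next
  case (update p a b)
  have "Poly_Mapping.update a b p = Poly_Mapping.single a b + p"
    using update(1)
    by (intro poly_mapping_eqI) (auto simp: lookup_update lookup_add lookup_single in_keys_iff when_def)
  then show ?case using assms(2) update by simp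
qed

lemma permute_poly_mult: "permute_poly \<sigma> (p * q) = permute_poly \<sigma> p * permute_poly \<sigma> q"
proof (induction p rule: single_add_induct)
  case (2 a b p)
  have "permute_poly \<sigma> (Poly_Mapping.single a b * q)
      = permute_poly \<sigma> (Poly_Mapping.single a b) * permute_poly \<sigma> q"
    by (induction q rule: single_add_induct)
      (simp_all add: permute_poly_add permute_poly_single mult_single permute_mon_add distrib_left)
  then show ?case
    using 2 by (simp add: permute_poly_add distrib_right)
qed simp

lemma permute_mon_zero [simp]: "permute_mon \<sigma> 0 = 0"
  by (rule poly_mapping_eqI) simp

lemma permute_poly_1 [simp]: "permute_poly \<sigma> 1 = 1"
  by (simp add: permute_poly_single flip: single_one)

lift_definition permute_rat :: "nat perm \<Rightarrow> 'k::field ratfun \<Rightarrow> 'k ratfun"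
  is "\<lambda>\<sigma> (p, q). (permute_poly \<sigma> p, permute_poly \<sigma> q)"
  by (auto simp flip: permute_poly_mult)

lemma permute_rat_Fract:
  "permute_rat \<sigma> (Fract p q) = Fract (permute_poly \<sigma> p) (permute_poly \<sigma> q)"
  by transfer auto

lemma permute_rat_1 [simp]: "permute_rat \<sigma> 1 = 1"
  by (simp add: One_fract_def permute_rat_Fract)

lemma permute_rat_0 [simp]: "permute_rat \<sigma> 0 = 0"
  by (simp add: Zero_fract_def permute_rat_Fract)

lemma permute_rat_add: "permute_rat \<sigma> (x + y) = permute_rat \<sigma> x + permute_rat \<sigma> y"
  by (cases x, cases y) (simp add: permute_rat_Fract permute_poly_add permute_poly_mult)

lemma permute_rat_mult: "permute_rat \<sigma> (x * y) = permute_rat \<sigma> x * permute_rat \<sigma> y"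
  by (cases x, cases y) (simp add: permute_rat_Fract permute_poly_mult)

lemma permute_rat_one [simp]: "permute_rat 1 x = x"
  by (cases x) (simp add: permute_rat_Fract)

lemma permute_rat_compose: "permute_rat (\<sigma> * \<tau>) x = permute_rat \<sigma> (permute_rat \<tau> x)"
  by (cases x) (simp add: permute_rat_Fract permute_poly_compose)

lemma fixing_inverse:
  assumes "\<sigma> \<in> fixing n"
  shows "inverse \<sigma> \<in> fixing n"
proof -
  have "inverse \<sigma> \<langle>$\<rangle> i = i" if "i < n" for i
    using assms that apply_inverse_apply(1)[of \<sigma> i] by (simp add: fixing_def)
  then show ?thesis by (simp add: fixing_def)
qed

lemma fixing_mono: "m \<le> n \<Longrightarrow> fixing n \<subseteq> fixing m"
  by (auto simp: fixing_def)

lemma permute_poly_smooth: "\<exists>n. \<forall>\<sigma>\<in>fixing n. permute_poly \<sigma> p = p"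
proof (induction p rule: single_add_induct)
  case (2 m c p)
  then obtain n where n: "\<forall>\<sigma>\<in>fixing n. permute_poly \<sigma> p = p" by blast
  obtain n' where n': "\<forall>i\<in>Poly_Mapping.keys m. i < n'"
    using finite_nat_set_iff_bounded[of "Poly_Mapping.keys m"] by auto
  have "permute_mon \<sigma> m = m" if "\<sigma> \<in> fixing n'" for \<sigma>
  proof (rule poly_mapping_eqI)
    fix i
    have *: "inverse \<sigma> \<langle>$\<rangle> j = j" "\<sigma> \<langle>$\<rangle> j = j" if "j \<in> Poly_Mapping.keys m" for j
      using that n' \<open>\<sigma> \<in> fixing n'\<close> fixing_inverse[of \<sigma> n'] by (auto simp: fixing_def)
    show "Poly_Mapping.lookup (permute_mon \<sigma> m) i = Poly_Mapping.lookup m i"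
    proof (cases "i \<in> Poly_Mapping.keys m")
      case True
      then show ?thesis by (simp add: *)
    next
      case False
      have "inverse \<sigma> \<langle>$\<rangle> i \<notin> Poly_Mapping.keys m"
      proof
        assume "inverse \<sigma> \<langle>$\<rangle> i \<in> Poly_Mapping.keys m"
        with *(2)[OF this] False show False by simp
      qed
      with False show ?thesis by (simp add: in_keys_iff)
    qed
  qed
  then have "\<forall>\<sigma>\<in>fixing (max n n'). permute_poly \<sigma> (Poly_Mapping.single m c + p) = Poly_Mapping.single m c + p"
    using n fixing_mono[of n "max n n'"] fixing_mono[of n' "max n n'"]
    by (simp add: permute_poly_add permute_poly_single subset_iff)
  then show ?case by blast
qed simp

lemma permute_rat_smooth: "\<exists>n. \<forall>\<sigma>\<in>fixing n. permute_rat \<sigma> x = x"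
proof (cases x)
  case (Fract p q)
  obtain m n where mn: "\<forall>\<sigma>\<in>fixing m. permute_poly \<sigma> p = p" "\<forall>\<sigma>\<in>fixing n. permute_poly \<sigma> q = q"
    using permute_poly_smooth by metis
  have "permute_rat \<sigma> x = x" if "\<sigma> \<in> fixing (max m n)" for \<sigma>
  proof -
    have "\<sigma> \<in> fixing m" "\<sigma> \<in> fixing n"
      using that fixing_mono[of m "max m n"] fixing_mono[of n "max m n"] by auto
    with mn show ?thesis unfolding Fract(1) permute_rat_Fract by metis
  qed
  then show ?thesis by blast
qed


section \<open>Smooth semilinear representations\<close>

text \<open>
  The underlying vector space is a subspace \<^term>\<open>carr M\<close> of a vector space structure on the type
  \<^typ>\<open>'m\<close>; the group need only act on \<^term>\<open>carr M\<close>.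
\<close>

record (overloaded) ('k, 'm) semirep =
  carr :: "'m set"
  scal :: "'k ratfun \<Rightarrow> 'm \<Rightarrow> 'm"
  act :: "nat perm \<Rightarrow> 'm \<Rightarrow> 'm"

locale smooth_rep = vector_space "scal M"
  for M :: "('k::field, 'm::ab_group_add) semirep" +
  assumes subspace_carr: "subspace (carr M)"
    and act_closed: "v \<in> carr M \<Longrightarrow> act M \<sigma> v \<in> carr M"
    and act_one: "v \<in> carr M \<Longrightarrow> act M 1 v = v"
    and act_mult: "v \<in> carr M \<Longrightarrow> act M (\<sigma> * \<tau>) v = act M \<sigma> (act M \<tau> v)"
    and act_add: "v \<in> carr M \<Longrightarrow> w \<in> carr M \<Longrightarrow> act M \<sigma> (v + w) = act M \<sigma> v + act M \<sigma> w"
    and act_scal: "v \<in> carr M \<Longrightarrow> act M \<sigma> (scal M a v) = scal M (permute_rat \<sigma> a) (act M \<sigma> v)"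
    and smooth: "v \<in> carr M \<Longrightarrow> \<exists>n. \<forall>\<sigma>\<in>fixing n. act M \<sigma> v = v"

definition morphism ::
    "('k, 'a::ab_group_add) semirep \<Rightarrow> ('k, 'b::ab_group_add) semirep \<Rightarrow> ('a \<Rightarrow> 'b) \<Rightarrow> bool" where
  "morphism A B f \<longleftrightarrow>
     (\<forall>v\<in>carr A. f v \<in> carr B) \<and>
     (\<forall>v\<in>carr A. \<forall>w\<in>carr A. f (v + w) = f v + f w) \<and>
     (\<forall>a. \<forall>v\<in>carr A. f (scal A a v) = scal B a (f v)) \<and>
     (\<forall>\<sigma>. \<forall>v\<in>carr A. f (act A \<sigma> v) = act B \<sigma> (f v))"

text \<open>
  The test objects \<open>T\<close> may be taken over the same type as \<open>A\<close>, because kernels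
  live there; see \<open>monomorphism_iff_inj\<close> below.
\<close>

definition monomorphism ::
    "('k::field, 'a::ab_group_add) semirep \<Rightarrow> ('k, 'b::ab_group_add) semirep \<Rightarrow> ('a \<Rightarrow> 'b) \<Rightarrow> bool" where
  "monomorphism A B f \<longleftrightarrow> morphism A B f \<and>
     (\<forall>(T :: ('k, 'a) semirep) g h. smooth_rep T \<longrightarrow> morphism T A g \<longrightarrow> morphism T A h \<longrightarrow>
        (\<forall>x\<in>carr T. f (g x) = f (h x)) \<longrightarrow> (\<forall>x\<in>carr T. g x = h x))"

definition isomorphic ::
    "('k, 'a::ab_group_add) semirep \<Rightarrow> ('k, 'b::ab_group_add) semirep \<Rightarrow> bool" where
  "isomorphic A B \<longleftrightarrow> (\<exists>f g. morphism A B f \<and> morphism B A g \<and>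
     (\<forall>x\<in>carr A. g (f x) = x) \<and> (\<forall>y\<in>carr B. f (g y) = y))"

text \<open>
  A formula cannot quantify over types, so the types over which the test objects \<open>A\<close> and \<open>B\<close>
  range are parameters; injectivity in the category means that this holds for all types
  \<open>'a\<close> and \<open>'b\<close>.
\<close>

definition injective_object ::
    "'a::ab_group_add itself \<Rightarrow> 'b::ab_group_add itself \<Rightarrow>
     ('k::field, 'm::ab_group_add) semirep \<Rightarrow> bool" where
  "injective_object _ _ Q \<longleftrightarrow> smooth_rep Q \<and>
     (\<forall>(A :: ('k, 'a) semirep) (B :: ('k, 'b) semirep) f g.
        smooth_rep A \<longrightarrow> smooth_rep B \<longrightarrow> monomorphism A B f \<longrightarrow> morphism A Q g \<longrightarrow>
        (\<exists>h. morphism B Q h \<and> (\<forall>x\<in>carr A. h (f x) = g x)))"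

lemma (in smooth_rep) zero_carr [simp]: "0 \<in> carr M"
  using subspace_carr by (rule subspace_0)

lemma morphism_zero:
  assumes "smooth_rep A" "smooth_rep B" "morphism A B f"
  shows "f 0 = 0"
proof -
  interpret A: smooth_rep A by fact
  have "f (0 + 0) = f 0 + f 0"
    using assms(3) A.zero_carr unfolding morphism_def by blast
  then show ?thesis by simp
qed

lemma (in smooth_rep) act_zero: "act M \<sigma> 0 = 0"
  using act_add[of 0 0 \<sigma>] by simp

lemma monomorphism_iff_inj:
  fixes A :: "('k::field, 'a::ab_group_add) semirep" and B :: "('k, 'b::ab_group_add) semirep"
  assumes A: "smooth_rep A" and B: "smooth_rep B"
  shows "monomorphism A B f \<longleftrightarrow> morphism A B f \<and> inj_on f (carr A)"
proof
  assume f: "monomorphism A B f"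
  interpret A: smooth_rep A by fact
  interpret B: smooth_rep B by fact
  from f have mor: "morphism A B f" by (simp add: monomorphism_def)
  have f0: "f 0 = 0" by (rule morphism_zero) fact+
  define T where "T = A\<lparr>carr := {x \<in> carr A. f x = 0}\<rparr>"
  have [simp]: "carr T = {x \<in> carr A. f x = 0}" "scal T = scal A" "act T = act A"
    by (simp_all add: T_def)
  have sub: "A.subspace (carr A)" by (rule A.subspace_carr)
  have "smooth_rep T"
  proof
    show "module.subspace (scal T) (carr T)"
      using mor sub f0 by (auto simp: A.subspace_def morphism_def)
  qed (use mor in \<open>auto simp: morphism_def A.act_closed A.act_one A.act_mult A.act_add A.act_scal
      A.smooth A.scale_right_distrib A.scale_left_distrib B.act_zero\<close>)
  moreover have "morphism T A (\<lambda>x. x)" "morphism T A (\<lambda>x. 0)"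
    by (auto simp: morphism_def A.act_zero)
  moreover have "\<forall>x\<in>carr T. f x = f 0" using f0 by simp
  ultimately have ker: "\<forall>x\<in>carr T. x = 0"
    using f unfolding monomorphism_def by blast
  have "x = y" if x: "x \<in> carr A" "y \<in> carr A" "f x = f y" for x y
  proof -
    have d: "x - y \<in> carr A" using A.subspace_diff[OF sub] x by blast
    have "f (x - y + y) = f (x - y) + f y"
      using mor d x unfolding morphism_def by blast
    then have "f (x - y) = 0" using x(3) by simp
    moreover have "x - y \<in> carr T" using d calculation by simp
    ultimately have "x - y = 0" using ker by blast
    then show "x = y" by simp
  qed
  with mor show "morphism A B f \<and> inj_on f (carr A)" by (auto intro: inj_onI)
next
  assume "morphism A B f \<and> inj_on f (carr A)"
  then show "monomorphism A B f"
    unfolding monomorphism_def morphism_def by (meson inj_on_eq_iff)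
qed


section \<open>Standard objects\<close>

text \<open>
  Pointwise operations: the coordinate at \<open>i\<close> lies in the \<open>i\<close>-th summand, and only finitely many
  coordinates are nonzero. Only the summands with index in \<open>J\<close> enter the carrier.
\<close>

definition direct_sum :: "'i set \<Rightarrow> ('i \<Rightarrow> ('k, 'm::ab_group_add) semirep) \<Rightarrow> ('k, 'i \<Rightarrow>\<^sub>0 'm) semirep" where
  "direct_sum J M = \<lparr>
     carr = {f. Poly_Mapping.keys f \<subseteq> J \<and> (\<forall>i\<in>J. Poly_Mapping.lookup f i \<in> carr (M i))},
     scal = (\<lambda>a. Poly_Mapping.mapp (\<lambda>i. scal (M i) a)),
     act = (\<lambda>\<sigma>. Poly_Mapping.mapp (\<lambda>i. act (M i) \<sigma>))\<rparr>"

text \<open>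
  The vectors \<open>1 \<otimes> e\<^sub>S\<close>, for \<open>S\<close> an \<open>r\<close>-element set of indices, form a basis of
  \<open>K \<otimes>\<^sub>k V\<^sup>r\<close>, so that its elements are the finitely supported families of coefficients
  \<open>\<Sum>\<^sub>S a\<^sub>S \<otimes> e\<^sub>S\<close>, and \<open>\<sigma> (\<Sum>\<^sub>S a\<^sub>S \<otimes> e\<^sub>S) = \<Sum>\<^sub>S \<sigma> a\<^sub>S \<otimes> e\<^bsub>\<sigma> S\<^esub>\<close>. The universal property of the
  tensor product is verified at the end of this theory.
\<close>

definition subset_rep :: "nat \<Rightarrow> ('k::field, nat set \<Rightarrow>\<^sub>0 'k ratfun) semirep" where
  "subset_rep r = \<lparr>
     carr = {f. \<forall>S\<in>Poly_Mapping.keys f. finite S \<and> card S = r},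
     scal = (\<lambda>a. Poly_Mapping.map ((*) a)),
     act = (\<lambda>\<sigma> f. Poly_Mapping.map (permute_rat \<sigma>)
                      (Poly_Mapping.map_key ((`) (apply (inverse \<sigma>))) f))\<rparr>"

text \<open>
  The type of the index set \<open>J\<close> of the direct sum is a parameter, as in \<^const>\<open>injective_object\<close>.
\<close>

definition standard :: "'i itself \<Rightarrow> ('k::field, 'm::ab_group_add) semirep \<Rightarrow> bool" where
  "standard _ M \<longleftrightarrow> smooth_rep M \<and>
     (\<exists>(J :: 'i set) (r :: 'i \<Rightarrow> nat). isomorphic M (direct_sum J (\<lambda>i. subset_rep (r i))))"


subsection \<open>The standard objects are objects\<close>

lemma lookup_scal_subset_rep:
  "Poly_Mapping.lookup (scal (subset_rep r) a f) S = a * Poly_Mapping.lookup f S"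
  by (auto simp: subset_rep_def map.rep_eq when_def)

lemma lookup_act_subset_rep:
  "Poly_Mapping.lookup (act (subset_rep r) \<sigma> f) S
     = permute_rat \<sigma> (Poly_Mapping.lookup f (apply (inverse \<sigma>) ` S))"
  by (auto simp: subset_rep_def map.rep_eq map_key.rep_eq when_def)

lemma carr_subset_rep:
  "f \<in> carr (subset_rep r) \<longleftrightarrow> (\<forall>S. Poly_Mapping.lookup f S \<noteq> 0 \<longrightarrow> finite S \<and> card S = r)"
  by (auto simp: subset_rep_def in_keys_iff)

lemma smooth_rep_subset_rep: "smooth_rep (subset_rep r :: ('k::field, _) semirep)"
proof -
  let ?M = "subset_rep r :: ('k, nat set \<Rightarrow>\<^sub>0 'k ratfun) semirep"
  interpret vector_space "scal ?M"
    by unfold_locales (auto intro!: poly_mapping_eqI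
        simp: lookup_scal_subset_rep lookup_add algebra_simps)
  show ?thesis
  proof
    show "subspace (carr ?M)"
      unfolding subspace_def
      by (auto simp: carr_subset_rep lookup_add lookup_scal_subset_rep) (metis add_0)+
  next
    fix v \<sigma> assume v: "v \<in> carr ?M"
    show "act ?M \<sigma> v \<in> carr ?M"
      unfolding carr_subset_rep lookup_act_subset_rep
    proof (intro allI impI)
      fix S
      assume "permute_rat \<sigma> (Poly_Mapping.lookup v (apply (inverse \<sigma>) ` S)) \<noteq> 0"
      then have "Poly_Mapping.lookup v (apply (inverse \<sigma>) ` S) \<noteq> 0"
        by (metis permute_rat_0)
      with v have "finite (apply (inverse \<sigma>) ` S) \<and> card (apply (inverse \<sigma>) ` S) = r"
        by (simp add: carr_subset_rep)
      moreover have "inj_on (apply (inverse \<sigma>)) S"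
        by (rule inj_on_subset[OF inj_apply]) simp
      ultimately show "finite S \<and> card S = r"
        by (auto simp: card_image dest: finite_imageD)
    qed
  next
    fix v assume v: "v \<in> carr ?M"
    define K where "K = Poly_Mapping.keys v"
    have fin: "finite (\<Union>K)"
      using v by (auto simp: K_def carr_subset_rep in_keys_iff)
    then obtain n where n: "\<forall>i\<in>\<Union>K. i < n"
      using finite_nat_set_iff_bounded by auto
    have "\<exists>N. \<forall>S. \<forall>\<sigma>\<in>fixing (N S). permute_rat \<sigma> (Poly_Mapping.lookup v S) = Poly_Mapping.lookup v S"
      by (intro choice allI permute_rat_smooth)
    then obtain N where N: "\<forall>S. \<forall>\<sigma>\<in>fixing (N S). permute_rat \<sigma> (Poly_Mapping.lookup v S) = Poly_Mapping.lookup v S"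
      by blast
    define m where "m = Max (insert n (N ` K))"
    have finK: "finite (insert n (N ` K))" by (simp add: K_def)
    have "act ?M \<sigma> v = v" if "\<sigma> \<in> fixing m" for \<sigma>
    proof (rule poly_mapping_eqI)
      fix S
      have nm: "n \<le> m" unfolding m_def using finK by (intro Max_ge) auto
      have Nm: "N S \<le> m" if "S \<in> K" for S
        unfolding m_def using finK that by (intro Max_ge) auto
      have \<sigma>n: "\<sigma> \<in> fixing n" "inverse \<sigma> \<in> fixing n"
        using that nm fixing_mono fixing_inverse by blast+
      have id: "apply \<sigma> ` S = S" "apply (inverse \<sigma>) ` S = S" if "S \<in> K" for S
      proof -
        have "\<forall>i\<in>S. \<sigma> \<langle>$\<rangle> i = i \<and> inverse \<sigma> \<langle>$\<rangle> i = i"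
          using \<sigma>n n that by (auto simp: fixing_def)
        then show "apply \<sigma> ` S = S" "apply (inverse \<sigma>) ` S = S" by (auto simp: image_def)
      qed
      show "Poly_Mapping.lookup (act ?M \<sigma> v) S = Poly_Mapping.lookup v S"
      proof (cases "S \<in> K")
        case True
        then show ?thesis
          using N Nm[OF True] fixing_mono[of "N S" m] that id[OF True]
          by (auto simp: lookup_act_subset_rep)
      next
        case False
        have "apply (inverse \<sigma>) ` S \<notin> K"
        proof
          assume *: "apply (inverse \<sigma>) ` S \<in> K"
          have "apply \<sigma> ` apply (inverse \<sigma>) ` S = S" by (simp add: image_image)
          with id(1)[OF *] * False show False by simp
        qed
        with False show ?thesis
          by (simp add: lookup_act_subset_rep K_def in_keys_iff)
      qed
    qed
    then show "\<exists>n. \<forall>\<sigma>\<in>fixing n. act ?M \<sigma> v = v" by blast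
  qed (auto intro!: poly_mapping_eqI simp: lookup_act_subset_rep lookup_scal_subset_rep lookup_add
      permute_rat_add permute_rat_mult permute_rat_compose image_image apply_times)
qed

lemma smooth_rep_direct_sum:
  fixes M :: "'i \<Rightarrow> ('k::field, 'm::ab_group_add) semirep"
  assumes M: "\<And>i. smooth_rep (M i)"
  shows "smooth_rep (direct_sum J M)"
proof -
  let ?D = "direct_sum J M"
  have vs: "vector_space (scal (M i))" for i
    using M smooth_rep.axioms by blast
  have sub: "module.subspace (scal (M i)) (carr (M i))" for i
    using M smooth_rep.subspace_carr by blast
  have mods: "module (scal (M i))" for i
    using vs by (simp add: module_iff_vector_space)
  have s0 [simp]: "scal (M i) a 0 = 0" for i a
    by (rule module.scale_zero_right[OF mods])
  have a0 [simp]: "act (M i) \<sigma> 0 = 0" for i \<sigma>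
    by (rule smooth_rep.act_zero[OF M])
  have lscal: "Poly_Mapping.lookup (scal ?D a f) i = scal (M i) a (Poly_Mapping.lookup f i)" for a f i
    by (auto simp: direct_sum_def lookup_mapp in_keys_iff when_def)
  have lact: "Poly_Mapping.lookup (act ?D \<sigma> f) i = act (M i) \<sigma> (Poly_Mapping.lookup f i)" for \<sigma> f i
    by (auto simp: direct_sum_def lookup_mapp in_keys_iff when_def)
  have z: "0 \<in> carr (M i)" for i by (rule smooth_rep.zero_carr[OF M])
  have carr: "f \<in> carr ?D \<longleftrightarrow> (\<forall>i. Poly_Mapping.lookup f i \<in> carr (M i) \<and> (i \<notin> J \<longrightarrow> Poly_Mapping.lookup f i = 0))" for f
  proof -
    have "f \<in> carr ?D \<longleftrightarrow> (\<forall>i. Poly_Mapping.lookup f i \<noteq> 0 \<longrightarrow> i \<in> J) \<and>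
        (\<forall>i\<in>J. Poly_Mapping.lookup f i \<in> carr (M i))"
      by (auto simp: direct_sum_def in_keys_iff)
    then show ?thesis using z by metis
  qed
  interpret vector_space "scal ?D"
    by unfold_locales (auto intro!: poly_mapping_eqI simp: lscal lookup_add
        module.scale_right_distrib[OF mods] module.scale_left_distrib[OF mods]
        module.scale_scale[OF mods] module.scale_one[OF mods])
  show ?thesis
  proof
    show "subspace (carr ?D)"
      unfolding subspace_def
      by (auto simp: carr lookup_add lscal z module.subspace_add[OF mods sub]
          module.subspace_scale[OF mods sub])
  next
    fix v assume v: "v \<in> carr ?D"
    have "\<forall>i. \<exists>n. \<forall>\<sigma>\<in>fixing n. act (M i) \<sigma> (Poly_Mapping.lookup v i) = Poly_Mapping.lookup v i"
      using v smooth_rep.smooth[OF M] by (auto simp: carr)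
    then have "\<exists>N. \<forall>i. \<forall>\<sigma>\<in>fixing (N i). act (M i) \<sigma> (Poly_Mapping.lookup v i) = Poly_Mapping.lookup v i"
      by (rule choice)
    then obtain N where N: "\<forall>i. \<forall>\<sigma>\<in>fixing (N i). act (M i) \<sigma> (Poly_Mapping.lookup v i) = Poly_Mapping.lookup v i"
      by blast
    define m where "m = Max (insert 0 (N ` Poly_Mapping.keys v))"
    have "act ?D \<sigma> v = v" if "\<sigma> \<in> fixing m" for \<sigma>
    proof (rule poly_mapping_eqI)
      fix i
      show "Poly_Mapping.lookup (act ?D \<sigma> v) i = Poly_Mapping.lookup v i"
      proof (cases "i \<in> Poly_Mapping.keys v")
        case True
        then have "N i \<le> m" unfolding m_def by (intro Max_ge) auto
        then have "\<sigma> \<in> fixing (N i)" using that fixing_mono by blast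
        then show ?thesis using N by (simp add: lact)
      qed (simp add: lact in_keys_iff)
    qed
    then show "\<exists>n. \<forall>\<sigma>\<in>fixing n. act ?D \<sigma> v = v" by blast
  qed (auto intro!: poly_mapping_eqI simp: carr lact lscal lookup_add smooth_rep.act_closed[OF M]
      smooth_rep.act_one[OF M] smooth_rep.act_mult[OF M] smooth_rep.act_add[OF M]
      smooth_rep.act_scal[OF M])
qed


subsection \<open>The tensor product description of \<^const>\<open>subset_rep\<close>\<close>

text \<open>
  Here \<^term>\<open>subset_space r\<close> is the \<open>k\<close>-vector space \<open>V\<^sup>r\<close>, and the lemmas state that
  \<^term>\<open>subset_rep r\<close> with \<^term>\<open>tensor\<close> is \<open>K \<otimes>\<^sub>k V\<^sup>r\<close> with the diagonal action.
\<close>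

definition const_rat :: "'k::field \<Rightarrow> 'k ratfun" where
  "const_rat c = Fract (Poly_Mapping.single 0 c) 1"

definition subset_space :: "nat \<Rightarrow> (nat set \<Rightarrow>\<^sub>0 'k::field) set" where
  "subset_space r = {v. \<forall>S\<in>Poly_Mapping.keys v. finite S \<and> card S = r}"

definition tensor :: "'k::field ratfun \<Rightarrow> (nat set \<Rightarrow>\<^sub>0 'k) \<Rightarrow> (nat set \<Rightarrow>\<^sub>0 'k ratfun)" where
  "tensor a v = Poly_Mapping.map (\<lambda>c. a * const_rat c) v"

lemma const_rat_0 [simp]: "const_rat 0 = 0"
  by (simp add: const_rat_def Zero_fract_def)

lemma const_rat_1 [simp]: "const_rat 1 = 1"
  by (simp add: const_rat_def One_fract_def)

lemma const_rat_add: "const_rat (c + d) = const_rat c + const_rat d"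
  by (simp add: const_rat_def single_add)

lemma const_rat_mult: "const_rat (c * d) = const_rat c * const_rat d"
  by (simp add: const_rat_def mult_single)

lemma permute_rat_const [simp]: "permute_rat \<sigma> (const_rat c) = const_rat c"
  by (simp add: const_rat_def permute_rat_Fract permute_poly_single)

lemma lookup_tensor: "Poly_Mapping.lookup (tensor a v) S = a * const_rat (Poly_Mapping.lookup v S)"
  by (auto simp: tensor_def map.rep_eq when_def)

lemma tensor_closed: "v \<in> subset_space r \<Longrightarrow> tensor a v \<in> carr (subset_rep r)"
  unfolding carr_subset_rep subset_space_def lookup_tensor
  by (metis (mono_tags, lifting) const_rat_0 in_keys_iff mem_Collect_eq mult_zero_right)

lemma tensor_add_left: "tensor (a + b) v = tensor a v + tensor b v"
  by (rule poly_mapping_eqI) (simp add: lookup_tensor lookup_add algebra_simps)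

lemma tensor_add_right: "tensor a (v + w) = tensor a v + tensor a w"
  by (rule poly_mapping_eqI) (simp add: lookup_tensor lookup_add const_rat_add algebra_simps)

lemma tensor_balanced: "tensor (a * const_rat c) v = tensor a (Poly_Mapping.map ((*) c) v)"
  by (rule poly_mapping_eqI) (auto simp: lookup_tensor map.rep_eq const_rat_mult when_def)

lemma scal_tensor: "scal (subset_rep r) b (tensor a v) = tensor (b * a) v"
  by (rule poly_mapping_eqI) (simp add: lookup_tensor lookup_scal_subset_rep)

lemma act_tensor:
  "act (subset_rep r) \<sigma> (tensor a v)
     = tensor (permute_rat \<sigma> a) (Poly_Mapping.map_key ((`) (apply (inverse \<sigma>))) v)"
proof (rule poly_mapping_eqI)
  fix S
  show "Poly_Mapping.lookup (act (subset_rep r) \<sigma> (tensor a v)) S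
     = Poly_Mapping.lookup (tensor (permute_rat \<sigma> a)
         (Poly_Mapping.map_key ((`) (apply (inverse \<sigma>))) v)) S"
    by (simp add: lookup_tensor lookup_act_subset_rep map_key.rep_eq permute_rat_mult)
qed

lemma sum_single_eq:
  assumes "finite K" "Poly_Mapping.keys f \<subseteq> K"
  shows "(\<Sum>S\<in>K. Poly_Mapping.single S (Poly_Mapping.lookup f S)) = f"
proof (rule poly_mapping_eqI)
  fix T
  have "Poly_Mapping.lookup (\<Sum>S\<in>K. Poly_Mapping.single S (Poly_Mapping.lookup f S)) T
      = (\<Sum>S\<in>K. if S = T then Poly_Mapping.lookup f S else 0)"
    by (simp add: lookup_sum lookup_single when_def)
  also have "\<dots> = Poly_Mapping.lookup f T"
    using assms by (auto simp: in_keys_iff)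
  finally show "Poly_Mapping.lookup (\<Sum>S\<in>K. Poly_Mapping.single S (Poly_Mapping.lookup f S)) T
      = Poly_Mapping.lookup f T" .
qed

lemma additive_on_sum:
  fixes \<phi> :: "'a::ab_group_add \<Rightarrow> 'x::ab_group_add"
  assumes "\<And>x y. x \<in> C \<Longrightarrow> y \<in> C \<Longrightarrow> \<phi> (x + y) = \<phi> x + \<phi> y"
    and "0 \<in> C" "\<And>x y. x \<in> C \<Longrightarrow> y \<in> C \<Longrightarrow> x + y \<in> C"
    and "finite K" "\<And>S. S \<in> K \<Longrightarrow> g S \<in> C"
  shows "(\<Sum>S\<in>K. g S) \<in> C \<and> \<phi> (\<Sum>S\<in>K. g S) = (\<Sum>S\<in>K. \<phi> (g S))"
  using assms(4,5)
proof (induction K rule: finite_induct)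
  case empty
  have "\<phi> (0 + 0) = \<phi> 0 + \<phi> 0" using assms(1,2) by blast
  then show ?case using assms(2) by simp
next
  case (insert x F)
  then show ?case using assms(1,3) by auto
qed

lemma tensor_universal:
  fixes \<beta> :: "'k::field ratfun \<Rightarrow> (nat set \<Rightarrow>\<^sub>0 'k) \<Rightarrow> 'x::ab_group_add"
  assumes left: "\<And>a b v. v \<in> subset_space r \<Longrightarrow> \<beta> (a + b) v = \<beta> a v + \<beta> b v"
    and right: "\<And>a v w. v \<in> subset_space r \<Longrightarrow> w \<in> subset_space r \<Longrightarrow> \<beta> a (v + w) = \<beta> a v + \<beta> a w"
    and balanced: "\<And>a c v. v \<in> subset_space r \<Longrightarrow>
      \<beta> (a * const_rat c) v = \<beta> a (Poly_Mapping.map ((*) c) v)"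
  shows "\<exists>\<phi>. (\<forall>f\<in>carr (subset_rep r). \<forall>g\<in>carr (subset_rep r). \<phi> (f + g) = \<phi> f + \<phi> g) \<and>
             (\<forall>a. \<forall>v\<in>subset_space r. \<phi> (tensor a v) = \<beta> a v)"
proof (intro exI conjI ballI allI)
  define \<phi> where "\<phi> f = (\<Sum>S\<in>Poly_Mapping.keys f. \<beta> (Poly_Mapping.lookup f S) (Poly_Mapping.single S 1))" for f
  let ?C = "carr (subset_rep r :: ('k, _) semirep)"
  have e: "Poly_Mapping.single S c \<in> subset_space r" if "finite S \<and> card S = r" for S and c :: 'k
    using that by (simp add: subset_space_def)
  have b0: "\<beta> 0 v = 0" if "v \<in> subset_space r" for v
    using left[OF that, of 0 0] by simp
  have \<phi>: "\<phi> f = (\<Sum>S\<in>K. \<beta> (Poly_Mapping.lookup f S) (Poly_Mapping.single S 1))"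
    if "finite K" "Poly_Mapping.keys f \<subseteq> K" "\<forall>S\<in>K. finite S \<and> card S = r" for f K
    unfolding \<phi>_def
    by (rule sum.mono_neutral_left) (use that b0 e in \<open>auto simp: in_keys_iff\<close>)
  fix f g assume fg: "f \<in> ?C" "g \<in> ?C"
  let ?K = "Poly_Mapping.keys f \<union> Poly_Mapping.keys g"
  have K: "\<forall>S\<in>?K. finite S \<and> card S = r"
    using fg by (auto simp: carr_subset_rep in_keys_iff)
  have "\<phi> (f + g) = (\<Sum>S\<in>?K. \<beta> (Poly_Mapping.lookup (f + g) S) (Poly_Mapping.single S 1))"
    using K Poly_Mapping.keys_add[of f g] by (intro \<phi>) simp_all
  also have "\<dots> = (\<Sum>S\<in>?K. \<beta> (Poly_Mapping.lookup f S) (Poly_Mapping.single S 1)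
      + \<beta> (Poly_Mapping.lookup g S) (Poly_Mapping.single S 1))"
    by (rule sum.cong) (use K in \<open>auto simp: lookup_add intro!: left e\<close>)
  also have "\<dots> = \<phi> f + \<phi> g"
    using K by (simp add: sum.distrib \<phi>[of ?K])
  finally show "\<phi> (f + g) = \<phi> f + \<phi> g" .
next
  define \<phi> where "\<phi> f = (\<Sum>S\<in>Poly_Mapping.keys f. \<beta> (Poly_Mapping.lookup f S) (Poly_Mapping.single S 1))" for f
  fix a and v :: "nat set \<Rightarrow>\<^sub>0 'k" assume v: "v \<in> subset_space r"
  let ?K = "Poly_Mapping.keys v"
  have K: "finite S \<and> card S = r" if "S \<in> ?K" for S
    using v that by (auto simp: subset_space_def)
  have e: "Poly_Mapping.single S c \<in> subset_space r" if "S \<in> ?K" for S and c :: 'k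
    using K[OF that] by (simp add: subset_space_def)
  have b0: "\<beta> 0 v = 0" if "v \<in> subset_space r" for v
    using left[OF that, of 0 0] by simp
  have "\<phi> (tensor a v) = (\<Sum>S\<in>?K. \<beta> (Poly_Mapping.lookup (tensor a v) S) (Poly_Mapping.single S 1))"
    unfolding \<phi>_def
    by (rule sum.mono_neutral_left) (auto simp: in_keys_iff lookup_tensor b0 e)
  also have "\<dots> = (\<Sum>S\<in>?K. \<beta> a (Poly_Mapping.single S (Poly_Mapping.lookup v S)))"
  proof (rule sum.cong)
    fix S assume S: "S \<in> ?K"
    have "Poly_Mapping.map ((*) c) (Poly_Mapping.single S 1) = Poly_Mapping.single S c" for c :: 'k
      by (rule poly_mapping_eqI) (auto simp: map.rep_eq lookup_single when_def)
    then show "\<beta> (Poly_Mapping.lookup (tensor a v) S) (Poly_Mapping.single S 1)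
        = \<beta> a (Poly_Mapping.single S (Poly_Mapping.lookup v S))"
      using balanced[OF e[OF S]] by (simp add: lookup_tensor)
  qed simp
  also have "\<dots> = \<beta> a (\<Sum>S\<in>?K. Poly_Mapping.single S (Poly_Mapping.lookup v S))"
  proof -
    have "x + y \<in> subset_space r" if "x \<in> subset_space r" "y \<in> subset_space r"
      for x y :: "nat set \<Rightarrow>\<^sub>0 'k"
      using that Poly_Mapping.keys_add[of x y] by (auto simp: subset_space_def)
    moreover have "(0 :: nat set \<Rightarrow>\<^sub>0 'k) \<in> subset_space r" by (simp add: subset_space_def)
    ultimately show ?thesis
      using additive_on_sum[of "subset_space r" "\<beta> a" ?K
          "\<lambda>S. Poly_Mapping.single S (Poly_Mapping.lookup v S)"] right e by simp
  qed
  also have "\<dots> = \<beta> a v" by (simp add: sum_single_eq)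
  finally show "\<phi> (tensor a v) = \<beta> a v" .
qed

lemma tensor_universal_unique:
  fixes \<phi> \<psi> :: "(nat set \<Rightarrow>\<^sub>0 'k::field ratfun) \<Rightarrow> 'x::ab_group_add"
  assumes add: "\<And>f g. f \<in> carr (subset_rep r) \<Longrightarrow> g \<in> carr (subset_rep r) \<Longrightarrow> \<phi> (f + g) = \<phi> f + \<phi> g"
      "\<And>f g. f \<in> carr (subset_rep r) \<Longrightarrow> g \<in> carr (subset_rep r) \<Longrightarrow> \<psi> (f + g) = \<psi> f + \<psi> g"
    and tensor: "\<And>a v. v \<in> subset_space r \<Longrightarrow> \<phi> (tensor a v) = \<psi> (tensor a v)"
    and f: "f \<in> carr (subset_rep r)"
  shows "\<phi> f = \<psi> f"
proof -
  let ?C = "carr (subset_rep r :: ('k, _) semirep)"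
  let ?K = "Poly_Mapping.keys f"
  let ?g = "\<lambda>S. Poly_Mapping.single S (Poly_Mapping.lookup f S)"
  have K: "finite S \<and> card S = r" if "S \<in> ?K" for S
    using f that by (auto simp: carr_subset_rep in_keys_iff)
  have g: "?g S = tensor (Poly_Mapping.lookup f S) (Poly_Mapping.single S 1)" for S
    by (rule poly_mapping_eqI) (simp add: lookup_tensor lookup_single when_def)
  have e: "(Poly_Mapping.single S 1 :: nat set \<Rightarrow>\<^sub>0 'k) \<in> subset_space r" if "S \<in> ?K" for S
    using K[OF that] by (simp add: subset_space_def)
  have C: "?g S \<in> ?C" if "S \<in> ?K" for S
    unfolding g by (rule tensor_closed) (rule e[OF that])
  interpret smooth_rep "subset_rep r :: ('k, _) semirep" by (rule smooth_rep_subset_rep)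
  note cl = zero_carr subspace_add[OF subspace_carr]
  have sum: "\<phi> (\<Sum>S\<in>?K. ?g S) = (\<Sum>S\<in>?K. \<phi> (?g S))" "\<psi> (\<Sum>S\<in>?K. ?g S) = (\<Sum>S\<in>?K. \<psi> (?g S))"
    using additive_on_sum[of ?C \<phi> ?K ?g] additive_on_sum[of ?C \<psi> ?K ?g] add cl C by simp_all
  have "(\<Sum>S\<in>?K. \<phi> (?g S)) = (\<Sum>S\<in>?K. \<psi> (?g S))"
    by (rule sum.cong) (simp_all add: g tensor e)
  with sum show ?thesis by (simp add: sum_single_eq)
qed

end

theory Submission
  imports Defs "HOL-Computational_Algebra.Formal_Laurent_Series" "HOL-Combinatorics.Permutations"
begin

text \<open>
  Let \<open>A \<subseteq> B\<close> and let \<open>g\<close> map \<open>A\<close> to a standard object \<open>Q\<close>. By Zorn's lemma it suffices to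
  extend \<open>g\<close> to one more vector \<open>v\<close>. Two observations make this possible.

  First, it is enough to find an extension that is equivariant under the pointwise stabilizer of
  \<open>0, \<dots>, N - 1\<close> for some \<open>N\<close>. Conjugating it with the shift \<open>s : i \<mapsto> i + 1\<close> lowers \<open>N\<close> by one,
  provided that \<open>Q\<close> has an equivariant retraction onto its shifted copy. On coefficients this
  retraction is the constant term of the Laurent expansion in the freed variable.

  Second, if \<open>v\<close> is fixed by the stabilizer of \<open>n\<close> indices, its translates are indexed by
  \<open>n\<close>-element sets, up to a finite group that is removed by Dedekind's independence of
  characters. If the translates are independent modulo those of lower degree, \<open>g\<close> is extended by
  zero. Otherwise a nontrivial relation, moved so that all its sets but one meet the indices
  below a larger \<open>N\<close>, shows that for this \<open>N\<close> fewer generators of degree \<open>n\<close> are needed. As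
  translates that meet the fixed indices have lower degree, induction on \<open>n\<close> applies.
\<close>

section \<open>Finitary permutations\<close>

text \<open>The permutations \<open>rot m\<close> converge pointwise to the shift \<open>i \<mapsto> i + 1\<close>.\<close>

fun rot :: "nat \<Rightarrow> nat perm" where
  "rot 0 = 1"
| "rot (Suc m) = rot m * \<langle>m \<leftrightarrow> Suc m\<rangle>"

lemma apply_rot: "rot m \<langle>$\<rangle> i = (if i < m then Suc i else if i = m then 0 else i)"
proof (induction m arbitrary: i)
  case (Suc m)
  have "\<langle>m \<leftrightarrow> Suc m\<rangle> \<langle>$\<rangle> i = (if i = m then Suc m else if i = Suc m then m else i)"
    by auto
  then show ?case by (auto simp: apply_times Suc)
qed simp

lemma apply_inverse_eq_iff: "inverse \<sigma> \<langle>$\<rangle> i = j \<longleftrightarrow> i = \<sigma> \<langle>$\<rangle> j"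
  by (metis apply_inverse_apply)

lemma apply_inverse_rot:
  "inverse (rot m) \<langle>$\<rangle> i = (if i = 0 then m else if i \<le> m then i - 1 else i)"
  by (auto simp: apply_inverse_eq_iff apply_rot)

lemma perm_inverse_inverse [simp]: "inverse (inverse \<sigma>) = \<sigma>" for \<sigma> :: "'a perm"
  by (simp add: perm_eq_iff apply_inverse_eq_iff)

lemma inverse_fixing [simp]: "inverse \<sigma> \<in> fixing n \<longleftrightarrow> \<sigma> \<in> fixing n"
  by (metis fixing_inverse perm_inverse_inverse)

lemma fixing_mult: "\<sigma> \<in> fixing n \<Longrightarrow> \<tau> \<in> fixing n \<Longrightarrow> \<sigma> * \<tau> \<in> fixing n"
  by (simp add: fixing_def apply_times)

lemma one_fixing [simp]: "1 \<in> fixing n"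
  by (simp add: fixing_def)

lemma fixing_0 [simp]: "fixing 0 = UNIV"
  by (simp add: fixing_def)

lemma fixing_le: "\<sigma> \<in> fixing n \<Longrightarrow> m \<le> n \<Longrightarrow> \<sigma> \<in> fixing m"
  using fixing_mono by blast

lemma perm_bounded: "\<exists>m. \<forall>i\<ge>m. \<sigma> \<langle>$\<rangle> i = i" for \<sigma> :: "nat perm"
proof -
  obtain m where "\<forall>i\<in>affected \<sigma>. i < m"
    using finite_nat_set_iff_bounded[of "affected \<sigma>"] by auto
  then show ?thesis by (metis in_affected linorder_not_le)
qed

text \<open>The domain \<open>A\<close> and its image are finite of equal size, so a bijection from
  the image minus \<open>A\<close> back to \<open>A\<close> minus the image closes the partial
  injection up to a finitary permutation.\<close>

lemma extend_to_perm:
  assumes "finite A" "inj_on f A"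
  shows "\<exists>\<sigma> :: nat perm. (\<forall>i\<in>A. \<sigma> \<langle>$\<rangle> i = f i) \<and> (\<forall>i. i \<notin> A \<union> f ` A \<longrightarrow> \<sigma> \<langle>$\<rangle> i = i)"
proof -
  have fin: "finite (f ` A - A)" "finite (A - f ` A)"
    using assms by auto
  have "card (f ` A - A) = card (A - f ` A)"
    using assms by (simp add: card_Diff_subset_Int card_image Int_commute)
  with fin obtain g where g: "bij_betw g (f ` A - A) (A - f ` A)"
    by (metis finite_same_card_bij)
  define h where "h i = (if i \<in> A then f i else if i \<in> f ` A then g i else i)" for i
  have "bij_betw h A (f ` A)"
    using assms(2) by (auto simp: h_def bij_betw_def inj_on_def)
  moreover have "bij_betw h (f ` A - A) (A - f ` A)"
    by (rule iffD2[OF bij_betw_cong g]) (auto simp: h_def)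
  moreover have "bij_betw h (- (A \<union> f ` A)) (- (A \<union> f ` A))"
    by (rule iffD2[OF bij_betw_cong bij_betw_id]) (auto simp: h_def)
  ultimately have "bij_betw h (A \<union> (f ` A - A) \<union> - (A \<union> f ` A)) (f ` A \<union> (A - f ` A) \<union> - (A \<union> f ` A))"
    by (intro bij_betw_combine) auto
  moreover have "A \<union> (f ` A - A) \<union> - (A \<union> f ` A) = UNIV" "f ` A \<union> (A - f ` A) \<union> - (A \<union> f ` A) = UNIV"
    by auto
  ultimately have "bij h" by simp
  moreover have "finite {i. h i \<noteq> i}"
    by (rule finite_subset[of _ "A \<union> f ` A"]) (use assms in \<open>auto simp: h_def\<close>)
  ultimately have "Perm h \<langle>$\<rangle> i = h i" for i
    by (simp add: Perm_inverse)
  then show ?thesis by (auto simp: h_def intro!: exI[of _ "Perm h"])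
qed

section \<open>The constant term in the first variable\<close>

text \<open>
  A rational function is expanded as a Laurent series in the variable with index 0, whose
  coefficients involve the other variables, renumbered by \<open>i + 1 \<mapsto> i\<close>. Since this renumbering
  inverts the shift, the constant term retracts the field onto its shifted copy.
\<close>

definition prepend :: "nat \<Rightarrow> (nat \<Rightarrow>\<^sub>0 nat) \<Rightarrow> (nat \<Rightarrow>\<^sub>0 nat)" where
  "prepend n m = Abs_poly_mapping (\<lambda>i. case i of 0 \<Rightarrow> n | Suc j \<Rightarrow> Poly_Mapping.lookup m j)"

lemma lookup_prepend [simp]:
  "Poly_Mapping.lookup (prepend n m) i = (case i of 0 \<Rightarrow> n | Suc j \<Rightarrow> Poly_Mapping.lookup m j)"
proof -
  have "{i. (case i of 0 \<Rightarrow> n | Suc j \<Rightarrow> Poly_Mapping.lookup m j) \<noteq> 0} \<subseteq> insert 0 (Suc ` Poly_Mapping.keys m)"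
    by (rule subsetI) (auto split: nat.splits simp: in_keys_iff)
  then have "finite {i. (case i of 0 \<Rightarrow> n | Suc j \<Rightarrow> Poly_Mapping.lookup m j) \<noteq> 0}"
    by (rule finite_subset) simp
  then show ?thesis by (simp add: prepend_def)
qed

lemma prepend_inject [simp]: "prepend n m = prepend n' m' \<longleftrightarrow> n = n' \<and> m = m'"
proof
  assume eq: "prepend n m = prepend n' m'"
  have "n = n'" using arg_cong[OF eq, of "\<lambda>f. Poly_Mapping.lookup f 0"] by simp
  moreover have "m = m'"
  proof (rule poly_mapping_eqI)
    fix i
    show "Poly_Mapping.lookup m i = Poly_Mapping.lookup m' i"
      using arg_cong[OF eq, of "\<lambda>f. Poly_Mapping.lookup f (Suc i)"] by simp
  qed
  ultimately show "n = n' \<and> m = m'" by simp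
qed simp

lemma inj_prepend [simp]: "inj (prepend n)"
  by (rule injI) simp

lemma prepend_cases: obtains n m' where "m = prepend n m'"
proof
  have inj: "inj Suc" by simp
  show "m = prepend (Poly_Mapping.lookup m 0) (Poly_Mapping.map_key Suc m)"
    by (rule poly_mapping_eqI) (simp add: map_key.rep_eq[OF inj] split: nat.splits)
qed

lemma prepend_add: "prepend n m + prepend n' m' = prepend (n + n') (m + m')"
  by (rule poly_mapping_eqI) (simp add: lookup_add split: nat.splits)

text \<open>The series variable \<open>fps_X\<close> stands for the variable with index 0.
  Coefficients are placed in the fraction field so that Laurent series over them form a field and
  quotients of expansions make sense.\<close>

definition expand_poly :: "((nat \<Rightarrow>\<^sub>0 nat) \<Rightarrow>\<^sub>0 'k::field) \<Rightarrow> 'k ratfun fps" where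
  "expand_poly p = Abs_fps (\<lambda>n. Fraction_Field.Fract (Poly_Mapping.map_key (prepend n) p) 1)"

lemma nth_expand_poly [simp]:
  "fps_nth (expand_poly p) n = Fraction_Field.Fract (Poly_Mapping.map_key (prepend n) p) 1"
  by (simp add: expand_poly_def)

lemma expand_poly_zero [simp]: "expand_poly 0 = 0"
  by (simp add: fps_eq_iff Zero_fract_def)

lemma expand_poly_add: "expand_poly (p + q) = expand_poly p + expand_poly q"
  by (simp add: fps_eq_iff map_key_plus)

text \<open>Every monomial has the form \<open>prepend n m'\<close>, so the coefficients of the
  series determine the polynomial. This keeps denominators nonzero under expansion.\<close>

lemma expand_poly_eq_0_iff [simp]: "expand_poly p = 0 \<longleftrightarrow> p = 0"
proof
  assume *: "expand_poly p = 0"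
  show "p = 0"
  proof (rule poly_mapping_eqI)
    fix m
    obtain n m' where m: "m = prepend n m'" by (rule prepend_cases)
    have "Fraction_Field.Fract (Poly_Mapping.map_key (prepend n) p) 1 = 0"
      using arg_cong[OF *, of "\<lambda>f. fps_nth f n"] by simp
    then have "Poly_Mapping.map_key (prepend n) p = 0"
      by (simp add: Zero_fract_def eq_fract)
    then have "Poly_Mapping.lookup (Poly_Mapping.map_key (prepend n) p) m' = 0" by simp
    then show "Poly_Mapping.lookup p m = Poly_Mapping.lookup 0 m"
      by (simp add: m map_key.rep_eq)
  qed
qed simp

lemma expand_poly_single:
  "expand_poly (Poly_Mapping.single (prepend n m) c)
     = fps_const (Fraction_Field.Fract (Poly_Mapping.single m c) 1) * fps_X ^ n"
proof (rule fps_ext)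
  fix j
  have "Poly_Mapping.map_key (prepend j) (Poly_Mapping.single (prepend n m) c)
      = (if j = n then Poly_Mapping.single m c else 0)"
    by (rule poly_mapping_eqI) (auto simp: map_key.rep_eq lookup_single when_def)
  then show "fps_nth (expand_poly (Poly_Mapping.single (prepend n m) c)) j
      = fps_nth (fps_const (Fraction_Field.Fract (Poly_Mapping.single m c) 1) * fps_X ^ n) j"
    by (simp add: fps_X_power_nth Zero_fract_def)
qed

lemma fps_const_mult_single:
  "fps_const (Fraction_Field.Fract (Poly_Mapping.single (m + m') (b * b')) 1) * (fps_X ^ n * fps_X ^ n')
    = fps_const (Fraction_Field.Fract (Poly_Mapping.single m b) 1) * fps_X ^ n *
      (fps_const (Fraction_Field.Fract (Poly_Mapping.single m' b') 1) * fps_X ^ n')"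
proof -
  have "fps_const (Fraction_Field.Fract (Poly_Mapping.single (m + m') (b * b')) 1)
      = fps_const (Fraction_Field.Fract (Poly_Mapping.single m b) 1)
        * fps_const (Fraction_Field.Fract (Poly_Mapping.single m' b') 1)"
    by (simp add: mult_single)
  then show ?thesis by (simp only: mult.assoc mult.left_commute)
qed

text \<open>By additivity in both factors it suffices to multiply monomials, whose exponents add
  separately at index 0 and at the remaining indices.\<close>

lemma expand_poly_mult: "expand_poly (p * q) = expand_poly p * expand_poly q"
proof (induction p rule: single_add_induct)
  case (2 a b p)
  have "expand_poly (Poly_Mapping.single a b * q) = expand_poly (Poly_Mapping.single a b) * expand_poly q"
  proof (induction q rule: single_add_induct)
    case (2 a' b' q)
    obtain n m n' m' where "a = prepend n m" "a' = prepend n' m'" by (metis prepend_cases)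
    then show ?case
      using 2
      by (simp add: distrib_left expand_poly_add mult_single prepend_add expand_poly_single power_add
          fps_const_mult_single)
  qed simp
  then show ?case
    using 2 by (simp add: distrib_right expand_poly_add)
qed simp

definition expand :: "'k::field ratfun \<Rightarrow> 'k ratfun fls" where
  "expand x = (THE y. \<exists>p q. q \<noteq> 0 \<and> x = Fraction_Field.Fract p q \<and>
     y = fps_to_fls (expand_poly p) / fps_to_fls (expand_poly q))"

text \<open>Two representations of the same fraction satisfy a cross-multiplied polynomial identity.
  As \<open>expand_poly\<close> is multiplicative and kills only 0, their quotients of series agree,
  so the description in \<open>expand\<close> is unique.\<close>

lemma expand_Fract:
  assumes "q \<noteq> 0"
  shows "expand (Fraction_Field.Fract p q) = fps_to_fls (expand_poly p) / fps_to_fls (expand_poly q)"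
  unfolding expand_def
proof (rule the_equality)
  show "\<exists>p' q'. q' \<noteq> 0 \<and> Fraction_Field.Fract p q = Fraction_Field.Fract p' q' \<and>
      fps_to_fls (expand_poly p) / fps_to_fls (expand_poly q)
        = fps_to_fls (expand_poly p') / fps_to_fls (expand_poly q')"
    using assms by blast
next
  fix y
  assume "\<exists>p' q'. q' \<noteq> 0 \<and> Fraction_Field.Fract p q = Fraction_Field.Fract p' q' \<and>
      y = fps_to_fls (expand_poly p') / fps_to_fls (expand_poly q')"
  then obtain p' q' where *: "q' \<noteq> 0" "Fraction_Field.Fract p q = Fraction_Field.Fract p' q'"
    and y: "y = fps_to_fls (expand_poly p') / fps_to_fls (expand_poly q')"
    by blast
  have "p' * q = p * q'"
    using * assms by (simp add: eq_fract)
  then have "fps_to_fls (expand_poly p') * fps_to_fls (expand_poly q)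
      = fps_to_fls (expand_poly p) * fps_to_fls (expand_poly q')"
    by (simp only: flip: fls_times_fps_to_fls expand_poly_mult)
  moreover have "fps_to_fls (expand_poly q) \<noteq> 0" "fps_to_fls (expand_poly q') \<noteq> 0"
    using * assms by simp_all
  ultimately show "y = fps_to_fls (expand_poly p) / fps_to_fls (expand_poly q)"
    unfolding y by (metis frac_eq_eq)
qed

lemma expand_add: "expand (x + y) = expand x + expand y"
proof (cases x, cases y)
  fix a b c d :: "(nat \<Rightarrow>\<^sub>0 nat) \<Rightarrow>\<^sub>0 'a"
  assume *: "x = Fraction_Field.Fract a b" "b \<noteq> 0" "y = Fraction_Field.Fract c d" "d \<noteq> 0"
  then have "fps_to_fls (expand_poly b) \<noteq> 0" "fps_to_fls (expand_poly d) \<noteq> 0" by simp_all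
  note add_frac_eq[OF this]
  moreover have "expand (x + y) = fps_to_fls (expand_poly (a * d + c * b)) / fps_to_fls (expand_poly (b * d))"
    using * by (simp only: add_fract expand_Fract mult_eq_0_iff simp_thms)
  ultimately show ?thesis
    using * by (simp only: simp_thms expand_Fract expand_poly_add expand_poly_mult fls_times_fps_to_fls fps_to_fls_plus)
qed

lemma expand_mult: "expand (x * y) = expand x * expand y"
proof (cases x, cases y)
  fix a b c d :: "(nat \<Rightarrow>\<^sub>0 nat) \<Rightarrow>\<^sub>0 'a"
  assume *: "x = Fraction_Field.Fract a b" "b \<noteq> 0" "y = Fraction_Field.Fract c d" "d \<noteq> 0"
  then have "expand (x * y) = fps_to_fls (expand_poly (a * c)) / fps_to_fls (expand_poly (b * d))"
    by (simp only: mult_fract expand_Fract mult_eq_0_iff simp_thms)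
  with * show ?thesis
    by (simp only: simp_thms expand_Fract expand_poly_mult fls_times_fps_to_fls times_divide_times_eq)
qed

section \<open>Compatibility of the expansion with permutations and the shift\<close>

definition map_fls :: "('a \<Rightarrow> 'b) \<Rightarrow> 'a::zero fls \<Rightarrow> 'b::zero fls" where
  "map_fls f F = Abs_fls (\<lambda>n. f (fls_nth F n))"

text \<open>Since \<open>f\<close> preserves 0, the mapped coefficients still vanish below the
  subdegree of \<open>F\<close> and therefore form a Laurent series.\<close>

lemma nth_map_fls:
  assumes "f 0 = 0"
  shows "fls_nth (map_fls f F) n = f (fls_nth F n)"
  unfolding map_fls_def
  by (rule nth_Abs_fls_lower_bound[of "fls_subdegree F"]) (simp add: assms)

lemma permute_rat_inverse [simp]:
  "permute_rat (inverse \<sigma>) (permute_rat \<sigma> x) = x"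
  "permute_rat \<sigma> (permute_rat (inverse \<sigma>) x) = x"
  by (simp_all flip: permute_rat_compose)

lemma permute_rat_eq_0_iff [simp]: "permute_rat \<sigma> x = 0 \<longleftrightarrow> x = 0"
  by (metis permute_rat_0 permute_rat_inverse(1))

text \<open>The product formula sums over a range given by the subdegrees. As
  \<open>permute_rat\<close> keeps nonzero coefficients nonzero, subdegrees are preserved and both
  sides are sums over the same range.\<close>

lemma map_permute_rat_mult:
  "map_fls (permute_rat \<sigma>) (F * G) = map_fls (permute_rat \<sigma>) F * map_fls (permute_rat \<sigma>) G"
proof (rule fls_eqI)
  fix n
  have sub: "fls_subdegree (map_fls (permute_rat \<sigma>) F) = fls_subdegree F" for F :: "'a ratfun fls"
  proof (cases "F = 0")
    case True
    have "map_fls (permute_rat \<sigma>) F = 0"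
      by (rule fls_eqI) (simp add: nth_map_fls True)
    then show ?thesis using True by simp
  next
    case False
    then show ?thesis
      by (intro fls_subdegree_eqI) (simp_all add: nth_map_fls)
  qed
  have sum: "permute_rat \<sigma> (sum h A) = (\<Sum>i\<in>A. permute_rat \<sigma> (h i))"
    for h :: "int \<Rightarrow> 'a ratfun" and A
    by (induction A rule: infinite_finite_induct) (simp_all add: permute_rat_add)
  show "fls_nth (map_fls (permute_rat \<sigma>) (F * G)) n
      = fls_nth (map_fls (permute_rat \<sigma>) F * map_fls (permute_rat \<sigma>) G) n"
    unfolding nth_map_fls[of "permute_rat \<sigma>", OF permute_rat_0] fls_times_nth(1) sub sum permute_rat_mult ..
qed

lemma map_permute_rat_divide:
  "map_fls (permute_rat \<sigma>) (F / G) = map_fls (permute_rat \<sigma>) F / map_fls (permute_rat \<sigma>) G"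
proof (cases "G = 0")
  case False
  have one: "map_fls (permute_rat \<sigma>) 1 = 1"
    by (rule fls_eqI) (simp add: nth_map_fls)
  have "map_fls (permute_rat \<sigma>) G * map_fls (permute_rat \<sigma>) (inverse G) = 1"
    unfolding map_permute_rat_mult[symmetric] right_inverse[OF False] by (rule one)
  then have "map_fls (permute_rat \<sigma>) G \<noteq> 0"
    by (metis mult_zero_left zero_neq_one)
  moreover have "F / G * G = F"
    using False by (rule nonzero_eq_divide_eq[THEN iffD1, OF _ refl])
  then have "map_fls (permute_rat \<sigma>) (F / G) * map_fls (permute_rat \<sigma>) G = map_fls (permute_rat \<sigma>) F"
    unfolding map_permute_rat_mult[symmetric] by (rule arg_cong)
  ultimately show ?thesis by (rule nonzero_eq_divide_eq[THEN iffD2])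
next
  case True
  have "map_fls (permute_rat \<sigma>) (0 :: 'a ratfun fls) = 0"
    by (rule fls_eqI) (simp add: nth_map_fls)
  then show ?thesis unfolding True by simp
qed

text \<open>For \<open>m\<close> beyond the support of \<sigma>, conjugation by \<open>rot m\<close>
  has the effect of conjugation by the shift, with the freed index 0 left fixed.\<close>

lemma apply_conj_rot:
  assumes "\<forall>i\<ge>m. \<sigma> \<langle>$\<rangle> i = i"
  shows "(rot m * \<sigma> * inverse (rot m)) \<langle>$\<rangle> 0 = 0"
    and "(rot m * \<sigma> * inverse (rot m)) \<langle>$\<rangle> (Suc i) = Suc (\<sigma> \<langle>$\<rangle> i)"
proof -
  have "\<sigma> \<langle>$\<rangle> i < m" if "i < m"
    using that assms by (metis apply_inverse_apply(1) linorder_not_le)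
  then show "(rot m * \<sigma> * inverse (rot m)) \<langle>$\<rangle> 0 = 0"
      "(rot m * \<sigma> * inverse (rot m)) \<langle>$\<rangle> (Suc i) = Suc (\<sigma> \<langle>$\<rangle> i)"
    using assms by (cases "i < m"; simp add: apply_times apply_inverse_rot apply_rot)+
qed

text \<open>The conjugated permutation leaves the series variable alone and permutes the renumbered
  variables of the coefficients as \<sigma> does.\<close>

lemma expand_conj:
  assumes \<sigma>: "\<forall>i\<ge>m. \<sigma> \<langle>$\<rangle> i = i"
  shows "expand (permute_rat (rot m * \<sigma> * inverse (rot m)) x) = map_fls (permute_rat \<sigma>) (expand x)"
proof -
  let ?\<tau> = "rot m * \<sigma> * inverse (rot m)"
  have "permute_mon (inverse ?\<tau>) (prepend n m') = prepend n (permute_mon (inverse \<sigma>) m')" for n m'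
    by (rule poly_mapping_eqI)
      (simp add: perm_inverse_inverse apply_conj_rot[OF \<sigma>] split: nat.split)
  then have "Poly_Mapping.map_key (prepend k) (permute_poly ?\<tau> p)
      = permute_poly \<sigma> (Poly_Mapping.map_key (prepend k) p)" for k and p :: "(nat \<Rightarrow>\<^sub>0 nat) \<Rightarrow>\<^sub>0 'a"
    by (intro poly_mapping_eqI) (simp add: map_key.rep_eq)
  then have poly: "fps_to_fls (expand_poly (permute_poly ?\<tau> p))
      = map_fls (permute_rat \<sigma>) (fps_to_fls (expand_poly p))" for p :: "(nat \<Rightarrow>\<^sub>0 nat) \<Rightarrow>\<^sub>0 'a"
    by (intro fls_eqI) (simp add: nth_map_fls permute_rat_Fract)
  show ?thesis
  proof (cases x)
    case (Fract a b)
    then show ?thesis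
      by (simp only: permute_rat_Fract expand_Fract permute_poly_eq_0_iff poly map_permute_rat_divide simp_thms)
  qed
qed

text \<open>Once \<open>m\<close> exceeds every index in \<open>p\<close>, \<open>rot m\<close> acts
  on \<open>p\<close> as the shift: variable 0 no longer occurs, and the renumbering in the
  coefficients undoes the shift.\<close>

lemma expand_poly_rot:
  "\<exists>m0. \<forall>m\<ge>m0. expand_poly (permute_poly (rot m) p) = fps_const (Fraction_Field.Fract p 1)"
proof (induction p rule: single_add_induct)
  case (2 a b p)
  then obtain m0 where m0: "\<forall>m\<ge>m0. expand_poly (permute_poly (rot m) p) = fps_const (Fraction_Field.Fract p 1)"
    by blast
  obtain m1 where m1: "\<forall>i\<in>Poly_Mapping.keys a. i < m1"
    using finite_nat_set_iff_bounded[of "Poly_Mapping.keys a"] by auto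
  have "permute_mon (rot m) a = prepend 0 a" if "m \<ge> m1" for m
  proof (rule poly_mapping_eqI)
    fix i
    have "Poly_Mapping.lookup a j = 0" if "j \<ge> m" for j
      using that m1 \<open>m \<ge> m1\<close> by (meson in_keys_iff leD order_trans)
    then show "Poly_Mapping.lookup (permute_mon (rot m) a) i = Poly_Mapping.lookup (prepend 0 a) i"
      by (auto simp: apply_inverse_rot split: nat.split)
  qed
  then have "expand_poly (permute_poly (rot m) (Poly_Mapping.single a b + p))
      = fps_const (Fraction_Field.Fract (Poly_Mapping.single a b + p) 1)" if "m \<ge> max m0 m1" for m
    using that m0 by (simp add: permute_poly_add expand_poly_add permute_poly_single expand_poly_single)
  then show ?case by blast
qed (simp flip: Zero_fract_def)

lemma expand_rot: "\<exists>m0. \<forall>m\<ge>m0. expand (permute_rat (rot m) x) = fls_const x"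
proof (cases x)
  case (Fract a b)
  obtain m1 m2 where m:
    "\<forall>m\<ge>m1. expand_poly (permute_poly (rot m) a) = fps_const (Fraction_Field.Fract a 1)"
    "\<forall>m\<ge>m2. expand_poly (permute_poly (rot m) b) = fps_const (Fraction_Field.Fract b 1)"
    using expand_poly_rot by metis
  have nz: "fls_const (Fraction_Field.Fract b 1) \<noteq> 0"
    using Fract(2) by (simp add: Zero_fract_def eq_fract)
  have "x * Fraction_Field.Fract b 1 = Fraction_Field.Fract a 1"
    using Fract by (simp add: eq_fract)
  then have "fls_const x * fls_const (Fraction_Field.Fract b 1) = fls_const (Fraction_Field.Fract a 1)"
    by simp
  then have "fls_const x = fls_const (Fraction_Field.Fract a 1) / fls_const (Fraction_Field.Fract b 1)"
    using nz by (metis nonzero_eq_divide_eq)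
  then have "expand (permute_rat (rot m) x) = fls_const x" if "m \<ge> max m1 m2" for m
    using that m Fract by (simp add: permute_rat_Fract expand_Fract fps_const_to_fls)
  then show ?thesis by blast
qed

definition const_term :: "'k::field ratfun \<Rightarrow> 'k ratfun" where
  "const_term x = fls_nth (expand x) 0"

lemma const_term_add: "const_term (x + y) = const_term x + const_term y"
  by (simp add: const_term_def expand_add)

lemma const_term_zero [simp]: "const_term 0 = 0"
  by (metis add.right_neutral add_left_cancel const_term_add)

lemma const_term_rot: "\<exists>m0. \<forall>m\<ge>m0. const_term (permute_rat (rot m) x) = x"
  unfolding const_term_def by (metis expand_rot fls_const_nth)

text \<open>The constant term is not multiplicative, but a shifted scalar expands to a constant
  series and can be pulled out. The bound \<open>m0\<close> is independent of \<open>y\<close>, so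
  it serves all coefficients of a vector at once.\<close>

lemma const_term_rot_mult:
  "\<exists>m0. \<forall>m\<ge>m0. \<forall>y. const_term (permute_rat (rot m) x * y) = x * const_term y"
  unfolding const_term_def expand_mult by (metis expand_rot fls_mult_const_nth(1))

lemma const_term_conj:
  assumes "\<forall>i\<ge>m. \<sigma> \<langle>$\<rangle> i = i"
  shows "const_term (permute_rat (rot m * \<sigma> * inverse (rot m)) x) = permute_rat \<sigma> (const_term x)"
  using expand_conj[OF assms, of x] by (simp add: const_term_def nth_map_fls)

section \<open>Contractions\<close>

text \<open>
  The limit of the operators \<open>act Q (rot m)\<close> is a shift operator \<open>s\<close> on \<open>Q\<close>. A contraction is an
  equivariant left inverse of \<open>s\<close> that takes scalars \<open>s a\<close> to \<open>a\<close>.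
\<close>

definition contraction :: "('k::field, 'm::ab_group_add) semirep \<Rightarrow> ('m \<Rightarrow> 'm) \<Rightarrow> bool" where
  "contraction Q \<pi> \<longleftrightarrow>
     (\<forall>q\<in>carr Q. \<pi> q \<in> carr Q) \<and>
     (\<forall>p\<in>carr Q. \<forall>q\<in>carr Q. \<pi> (p + q) = \<pi> p + \<pi> q) \<and>
     (\<forall>q\<in>carr Q. \<forall>\<^sub>F m in sequentially. \<pi> (act Q (rot m) q) = q) \<and>
     (\<forall>a. \<forall>q\<in>carr Q. \<forall>\<^sub>F m in sequentially.
        \<pi> (scal Q (permute_rat (rot m) a) q) = scal Q a (\<pi> q)) \<and>
     (\<forall>\<sigma>. \<forall>q\<in>carr Q. \<forall>\<^sub>F m in sequentially.
        \<pi> (act Q (rot m * \<sigma> * inverse (rot m)) q) = act Q \<sigma> (\<pi> q))"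

lemma contraction_zero: "smooth_rep Q \<Longrightarrow> contraction Q \<pi> \<Longrightarrow> \<pi> 0 = 0"
  unfolding contraction_def by (metis add.right_neutral add_left_cancel smooth_rep.zero_carr)

text \<open>The basis vectors \<open>e\<^sub>S\<close> with \<open>0 \<in> S\<close> are sent to 0.\<close>

definition subset_contraction :: "(nat set \<Rightarrow>\<^sub>0 'k::field ratfun) \<Rightarrow> (nat set \<Rightarrow>\<^sub>0 'k ratfun)" where
  "subset_contraction f = Poly_Mapping.map const_term (Poly_Mapping.map_key ((`) Suc) f)"

lemma lookup_subset_contraction:
  "Poly_Mapping.lookup (subset_contraction f) S = const_term (Poly_Mapping.lookup f (Suc ` S))"
proof -
  have "inj ((`) Suc)" by (rule injI) (simp add: inj_image_eq_iff)
  then show ?thesis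
    by (auto simp: subset_contraction_def map.rep_eq map_key.rep_eq when_def)
qed

text \<open>On the finite support of \<open>q\<close>, \<open>rot m\<close> with large
  \<open>m\<close> is the shift on index sets and on coefficients, and
  \<open>subset_contraction\<close> reverses both.\<close>

lemma subset_contraction_rot:
  assumes q: "q \<in> carr (subset_rep r)"
  shows "\<forall>\<^sub>F m in sequentially. subset_contraction (act (subset_rep r) (rot m) q) = q"
proof -
  have "finite (\<Union>(Poly_Mapping.keys q))"
    using q by (auto simp: carr_subset_rep in_keys_iff)
  then obtain n where n: "\<forall>i\<in>\<Union>(Poly_Mapping.keys q). i < n"
    using finite_nat_set_iff_bounded by auto
  have "\<forall>\<^sub>F m in sequentially. \<forall>S\<in>Poly_Mapping.keys q.
      const_term (permute_rat (rot m) (Poly_Mapping.lookup q S)) = Poly_Mapping.lookup q S"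
    by (rule eventually_ball_finite) (simp_all add: eventually_sequentially const_term_rot)
  then show ?thesis
    using eventually_ge_at_top[of n]
  proof eventually_elim
    case (elim m)
    show ?case
    proof (rule poly_mapping_eqI)
      fix S
      have id: "apply (inverse (rot m)) ` Suc ` T = T" if "\<forall>i\<in>T. i < m" for T
      proof -
        have "(\<lambda>i. inverse (rot m) \<langle>$\<rangle> (Suc i)) ` T = (\<lambda>i. i) ` T"
          by (rule image_cong) (use that in \<open>auto simp: apply_inverse_rot\<close>)
        then show ?thesis by (simp add: image_image)
      qed
      show "Poly_Mapping.lookup (subset_contraction (act (subset_rep r) (rot m) q)) S
          = Poly_Mapping.lookup q S"
      proof (cases "S \<in> Poly_Mapping.keys q")
        case True
        then have "\<forall>i\<in>S. i < m" using n elim(2) by force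
        then show ?thesis
          using True elim(1) by (simp add: lookup_subset_contraction lookup_act_subset_rep id)
      next
        case False
        \<comment> \<open>If the pulled back set were in the support, \<open>rot m\<close> would
          shift it. It would then have the same shift as \<open>S\<close>, hence equal
          \<open>S\<close>, which is outside the support.\<close>
        have "apply (inverse (rot m)) ` Suc ` S \<notin> Poly_Mapping.keys q"
        proof
          let ?T = "apply (inverse (rot m)) ` Suc ` S"
          assume *: "?T \<in> Poly_Mapping.keys q"
          then have "\<forall>i\<in>?T. i < m" using n elim(2) by force
          then have "apply (inverse (rot m)) ` Suc ` ?T = ?T" by (rule id)
          then have "Suc ` ?T = Suc ` S"
            by (simp only: inj_image_eq_iff[OF inj_apply])
          then have "?T = S" by (simp only: inj_image_eq_iff[OF inj_Suc])
          with * False show False by simp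
        qed
        then show ?thesis
          using False
          by (simp add: lookup_subset_contraction lookup_act_subset_rep in_keys_iff)
      qed
    qed
  qed
qed

lemma contraction_subset_rep: "contraction (subset_rep r :: ('k::field, _) semirep) subset_contraction"
  unfolding contraction_def
proof (intro conjI ballI allI)
  fix q assume q: "q \<in> carr (subset_rep r :: ('k, _) semirep)"
  show "subset_contraction q \<in> carr (subset_rep r :: ('k, _) semirep)"
    unfolding carr_subset_rep lookup_subset_contraction
  proof (intro allI impI)
    fix S assume "const_term (Poly_Mapping.lookup q (Suc ` S)) \<noteq> 0"
    then have "Poly_Mapping.lookup q (Suc ` S) \<noteq> 0" by (metis const_term_zero)
    with q have "finite (Suc ` S) \<and> card (Suc ` S) = r" by (simp add: carr_subset_rep)
    then show "finite S \<and> card S = r"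
      by (simp add: finite_image_iff card_image)
  qed
next
  fix p q
  show "subset_contraction (p + q) = subset_contraction p + subset_contraction q"
    by (rule poly_mapping_eqI) (simp add: lookup_subset_contraction lookup_add const_term_add)
next
  fix q assume "q \<in> carr (subset_rep r :: ('k, _) semirep)"
  then show "\<forall>\<^sub>F m in sequentially. subset_contraction (act (subset_rep r) (rot m) q) = q"
    by (rule subset_contraction_rot)
next
  fix a q
  have "\<forall>\<^sub>F m in sequentially. \<forall>y. const_term (permute_rat (rot m) a * y) = a * const_term y"
    unfolding eventually_sequentially by (rule const_term_rot_mult)
  then show "\<forall>\<^sub>F m in sequentially. subset_contraction (scal (subset_rep r) (permute_rat (rot m) a) q)
      = scal (subset_rep r) a (subset_contraction q)"
    by eventually_elim (rule poly_mapping_eqI, simp add: lookup_subset_contraction lookup_scal_subset_rep)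
next
  fix \<sigma> :: "nat perm" and q
  obtain n where n: "\<forall>i\<ge>n. \<sigma> \<langle>$\<rangle> i = i" using perm_bounded by blast
  show "\<forall>\<^sub>F m in sequentially. subset_contraction (act (subset_rep r) (rot m * \<sigma> * inverse (rot m)) q)
      = act (subset_rep r) \<sigma> (subset_contraction q)"
    using eventually_ge_at_top[of n]
  proof eventually_elim
    case (elim m)
    then have \<sigma>: "\<forall>i\<ge>m. \<sigma> \<langle>$\<rangle> i = i" using n by simp
    have "inverse (rot m * \<sigma> * inverse (rot m)) \<langle>$\<rangle> (Suc i) = Suc (inverse \<sigma> \<langle>$\<rangle> i)" for i
      unfolding apply_inverse_eq_iff by (simp add: apply_conj_rot[OF \<sigma>])
    then show ?case
      by (intro poly_mapping_eqI)
        (simp add: lookup_subset_contraction lookup_act_subset_rep const_term_conj[OF \<sigma>] image_image)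
  qed
qed

text \<open>Contracting coordinatewise works because an eventual statement has to be met only at the
  finitely many indices of the support; at all other indices both sides agree for every
  \<open>m\<close>.\<close>

lemma contraction_direct_sum:
  assumes M: "\<And>i. smooth_rep (M i)" and P: "\<And>i. contraction (M i) (P i)"
  shows "contraction (direct_sum J M) (Poly_Mapping.mapp P)"
proof -
  let ?D = "direct_sum J M"
  have s0: "scal (M i) a 0 = 0" for i a
    using M[of i] by (simp add: smooth_rep_def module.scale_zero_right module_iff_vector_space)
  have a0: "act (M i) \<sigma> 0 = 0" for i \<sigma>
    by (rule smooth_rep.act_zero[OF M])
  have p0: "P i 0 = 0" for i by (rule contraction_zero[OF M P])
  have lscal: "Poly_Mapping.lookup (scal ?D a f) i = scal (M i) a (Poly_Mapping.lookup f i)" for a f i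
    by (auto simp: direct_sum_def lookup_mapp in_keys_iff when_def s0)
  have lact: "Poly_Mapping.lookup (act ?D \<sigma> f) i = act (M i) \<sigma> (Poly_Mapping.lookup f i)" for \<sigma> f i
    by (auto simp: direct_sum_def lookup_mapp in_keys_iff when_def a0)
  have lp: "Poly_Mapping.lookup (Poly_Mapping.mapp P f) i = P i (Poly_Mapping.lookup f i)" for f i
    by (auto simp: lookup_mapp in_keys_iff when_def p0)
  have carr: "f \<in> carr ?D \<longleftrightarrow>
      (\<forall>i. Poly_Mapping.lookup f i \<in> carr (M i) \<and> (i \<notin> J \<longrightarrow> Poly_Mapping.lookup f i = 0))" for f
  proof -
    have "f \<in> carr ?D \<longleftrightarrow> (\<forall>i. Poly_Mapping.lookup f i \<noteq> 0 \<longrightarrow> i \<in> J) \<and>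
        (\<forall>i\<in>J. Poly_Mapping.lookup f i \<in> carr (M i))"
      by (auto simp: direct_sum_def in_keys_iff)
    then show ?thesis using smooth_rep.zero_carr[OF M] by metis
  qed
  have ev: "\<forall>\<^sub>F m in sequentially. f m = g"
    if "\<And>i. i \<in> Poly_Mapping.keys q \<Longrightarrow> \<forall>\<^sub>F m in sequentially. Poly_Mapping.lookup (f m) i = Poly_Mapping.lookup g i"
      and "\<And>i m. i \<notin> Poly_Mapping.keys q \<Longrightarrow> Poly_Mapping.lookup (f m) i = Poly_Mapping.lookup g i"
    for f g and q :: "'a \<Rightarrow>\<^sub>0 'c"
  proof -
    have "\<forall>\<^sub>F m in sequentially. \<forall>i\<in>Poly_Mapping.keys q. Poly_Mapping.lookup (f m) i = Poly_Mapping.lookup g i"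
      using that(1) by (intro eventually_ball_finite) simp_all
    then show ?thesis
      by eventually_elim (use that(2) in \<open>metis poly_mapping_eqI\<close>)
  qed
  note P' = P[unfolded contraction_def]
  show ?thesis
    unfolding contraction_def
  proof (intro conjI ballI allI)
    fix p q assume "p \<in> carr ?D" "q \<in> carr ?D"
    then show "Poly_Mapping.mapp P (p + q) = Poly_Mapping.mapp P p + Poly_Mapping.mapp P q"
      using P' by (intro poly_mapping_eqI) (simp add: lp lookup_add carr)
  next
    fix q assume "q \<in> carr ?D"
    then show "Poly_Mapping.mapp P q \<in> carr ?D"
      using P' by (simp add: lp p0 carr)
  next
    fix q assume "q \<in> carr ?D"
    then show "\<forall>\<^sub>F m in sequentially. Poly_Mapping.mapp P (act ?D (rot m) q) = q"
      using P' by (intro ev[of q]) (simp_all add: lp lact carr in_keys_iff a0 p0)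
  next
    fix a q assume "q \<in> carr ?D"
    then show "\<forall>\<^sub>F m in sequentially. Poly_Mapping.mapp P (scal ?D (permute_rat (rot m) a) q)
        = scal ?D a (Poly_Mapping.mapp P q)"
      using P' by (intro ev[of q]) (simp_all add: lp lscal carr in_keys_iff s0 p0)
  next
    fix \<sigma> q assume "q \<in> carr ?D"
    then show "\<forall>\<^sub>F m in sequentially. Poly_Mapping.mapp P (act ?D (rot m * \<sigma> * inverse (rot m)) q)
        = act ?D \<sigma> (Poly_Mapping.mapp P q)"
      using P' by (intro ev[of q]) (simp_all add: lp lact carr in_keys_iff a0 p0)
  qed
qed

section \<open>Extending equivariant maps\<close>

context smooth_rep
begin

definition invariant :: "nat \<Rightarrow> 'm \<Rightarrow> bool" where
  "invariant n v \<longleftrightarrow> (\<forall>\<sigma>\<in>fixing n. act M \<sigma> v = v)"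

lemma act_inverse [simp]:
  assumes "v \<in> carr M"
  shows "act M (inverse \<sigma>) (act M \<sigma> v) = v" "act M \<sigma> (act M (inverse \<sigma>) v) = v"
  using assms by (simp_all add: act_one flip: act_mult)

text \<open>The quotient of the two permutations lies in \<open>fixing n\<close>, so an invariant
  vector of level \<open>n\<close> sees only where the first \<open>n\<close> indices go.\<close>

lemma act_agree:
  assumes v: "v \<in> carr M" "invariant n v" and agree: "\<And>i. i < n \<Longrightarrow> \<sigma> \<langle>$\<rangle> i = \<tau> \<langle>$\<rangle> i"
  shows "act M \<sigma> v = act M \<tau> v"
proof -
  have "inverse \<tau> * \<sigma> \<in> fixing n"
    using agree by (simp add: fixing_def apply_times)
  then have "act M (inverse \<tau>) (act M \<sigma> v) = v"
    using v by (simp add: invariant_def flip: act_mult)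
  then show ?thesis using v by (metis act_closed act_inverse(2))
qed

lemma invariant_act:
  assumes v: "v \<in> carr M" "invariant n v" and \<sigma>: "\<And>i. i < n \<Longrightarrow> \<sigma> \<langle>$\<rangle> i < m"
  shows "invariant m (act M \<sigma> v)"
  unfolding invariant_def
proof
  fix \<tau> assume "\<tau> \<in> fixing m"
  then have "act M (\<tau> * \<sigma>) v = act M \<sigma> v"
    using v \<sigma> by (intro act_agree) (auto simp: apply_times fixing_def)
  then show "act M \<tau> (act M \<sigma> v) = act M \<sigma> v" using v by (simp add: act_mult)
qed

lemma act_sum:
  assumes "\<And>i. i \<in> I \<Longrightarrow> f i \<in> carr M"
  shows "act M \<sigma> (\<Sum>i\<in>I. f i) = (\<Sum>i\<in>I. act M \<sigma> (f i))"
  using assms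
proof (induction I rule: infinite_finite_induct)
  case (insert x F)
  then show ?case by (simp add: act_add subspace_sum[OF subspace_carr])
qed (simp_all add: act_zero)

lemma span_carr: "S \<subseteq> carr M \<Longrightarrow> span S \<subseteq> carr M"
  by (rule span_minimal[OF _ subspace_carr])

text \<open>A semilinear map twists the coefficients of a linear combination by a field
  automorphism, which still leaves a linear combination of the images.\<close>

lemma act_span:
  assumes "x \<in> span S" "S \<subseteq> carr M"
  shows "act M \<sigma> x \<in> span (act M \<sigma> ` S)"
proof -
  have "x \<in> carr M \<and> act M \<sigma> x \<in> span (act M \<sigma> ` S)"
    using assms(1)
  proof (induction rule: span_induct_alt)
    case base
    then show ?case by (simp add: act_zero span_zero)
  next
    case (step c x y)
    then have xy: "x \<in> carr M" "y \<in> carr M" using assms(2) by blast+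
    note cx = subspace_scale[OF subspace_carr xy(1), of c]
    have "act M \<sigma> (scal M c x + y) = scal M (permute_rat \<sigma> c) (act M \<sigma> x) + act M \<sigma> y"
      unfolding act_add[OF cx xy(2)] act_scal[OF xy(1)] ..
    moreover have "act M \<sigma> x \<in> span (act M \<sigma> ` S)"
      using step by (intro span_base imageI)
    ultimately show ?case
      using step subspace_add[OF subspace_carr cx xy(2)] by (simp add: span_add span_scale)
  qed
  then show ?thesis ..
qed

lemma act_span_closed:
  assumes "x \<in> span S" "S \<subseteq> carr M" "\<And>s. s \<in> S \<Longrightarrow> act M \<sigma> s \<in> span T"
  shows "act M \<sigma> x \<in> span T"
  using act_span[OF assms(1,2), of \<sigma>] span_minimal[OF _ subspace_span, of "act M \<sigma> ` S" T] assms(3)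
  by blast

text \<open>The shift is not a finitary permutation and acts only as a limit. The least level of
  invariance picks an \<open>m\<close> from which on \<open>act M (rot m) v\<close> is
  constant.\<close>

definition shift :: "'m \<Rightarrow> 'm" where
  "shift v = act M (rot (LEAST n. invariant n v)) v"

lemma eventually_shift:
  assumes v: "v \<in> carr M"
  shows "\<forall>\<^sub>F m in sequentially. act M (rot m) v = shift v"
proof -
  let ?n = "LEAST n. invariant n v"
  have "invariant ?n v"
    by (rule LeastI_ex) (use smooth[OF v] in \<open>simp add: invariant_def\<close>)
  then have "act M (rot m) v = shift v" if "m \<ge> ?n" for m
    unfolding shift_def using v that by (intro act_agree) (auto simp: apply_rot)
  then show ?thesis by (auto simp: eventually_sequentially)
qed

end

section \<open>Extensions equivariant under a stabilizer\<close>

locale extension_problem = B: smooth_rep B + Q: smooth_rep Q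
  for B :: "('k::field, 'b::ab_group_add) semirep" and Q :: "('k, 'm::ab_group_add) semirep" +
  fixes A :: "'b set" and g :: "'b \<Rightarrow> 'm" and \<pi> :: "'m \<Rightarrow> 'm"
  assumes A_subspace: "B.subspace A"
    and A_carr: "A \<subseteq> carr B"
    and A_act: "x \<in> A \<Longrightarrow> act B \<sigma> x \<in> A"
    and g_carr: "x \<in> A \<Longrightarrow> g x \<in> carr Q"
    and g_add: "x \<in> A \<Longrightarrow> y \<in> A \<Longrightarrow> g (x + y) = g x + g y"
    and g_scal: "x \<in> A \<Longrightarrow> g (scal B a x) = scal Q a (g x)"
    and g_act: "x \<in> A \<Longrightarrow> g (act B \<sigma> x) = act Q \<sigma> (g x)"
    and contraction: "contraction Q \<pi>"
begin

definition stable :: "nat \<Rightarrow> 'b set \<Rightarrow> bool" where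
  "stable N C \<longleftrightarrow> B.subspace C \<and> A \<subseteq> C \<and> C \<subseteq> carr B \<and> (\<forall>\<sigma>\<in>fixing N. \<forall>x\<in>C. act B \<sigma> x \<in> C)"

text \<open>Equivariance is demanded under \<open>fixing N\<close> only: such maps are easier to
  build, and \<open>extension_descend\<close> lowers \<open>N\<close> afterwards.\<close>

definition extension :: "nat \<Rightarrow> 'b set \<Rightarrow> ('b \<Rightarrow> 'm) \<Rightarrow> bool" where
  "extension N C h \<longleftrightarrow>
     (\<forall>x\<in>C. h x \<in> carr Q) \<and>
     (\<forall>x\<in>C. \<forall>y\<in>C. h (x + y) = h x + h y) \<and>
     (\<forall>a. \<forall>x\<in>C. h (scal B a x) = scal Q a (h x)) \<and>
     (\<forall>\<sigma>\<in>fixing N. \<forall>x\<in>C. h (act B \<sigma> x) = act Q \<sigma> (h x)) \<and>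
     (\<forall>x\<in>A. h x = g x)"

text \<open>
  For \<open>N = 0\<close> the new map is \<open>\<pi> \<circ> h \<circ> s\<close> with \<open>s\<close> the shift operator; \<open>rot N\<close> reduces the general
  case to that one.
\<close>

lemma extension_step:
  assumes C: "stable N C" and h: "extension (Suc N) C h"
  shows "\<exists>h'. extension N C h'"
proof
  \<comment> \<open>For \<open>m\<close> \<ge> \<open>N\<close>,
    \<open>inverse (rot N) * rot m\<close> lies in \<open>fixing N\<close>. In the limit
    \<open>y\<close> shifts only the indices from \<open>N\<close> on, so it maps \<open>C\<close>
    to itself and frees the index \<open>N\<close>.\<close>
  define y where "y x = act B (inverse (rot N)) (B.shift x)" for x
  define h' where "h' x = \<pi> (act Q (rot N) (h (y x)))" for x
  have sub: "B.subspace C" and AC: "A \<subseteq> C" and CB: "C \<subseteq> carr B"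
    and Cact: "\<And>\<sigma> x. \<sigma> \<in> fixing N \<Longrightarrow> x \<in> C \<Longrightarrow> act B \<sigma> x \<in> C"
    using C by (auto simp: stable_def)
  have pc: "\<And>q. q \<in> carr Q \<Longrightarrow> \<pi> q \<in> carr Q"
    and padd: "\<And>p q. p \<in> carr Q \<Longrightarrow> q \<in> carr Q \<Longrightarrow> \<pi> (p + q) = \<pi> p + \<pi> q"
    and prot: "\<And>q. q \<in> carr Q \<Longrightarrow> \<forall>\<^sub>F m in sequentially. \<pi> (act Q (rot m) q) = q"
    and pscal: "\<And>a q. q \<in> carr Q \<Longrightarrow>
      \<forall>\<^sub>F m in sequentially. \<pi> (scal Q (permute_rat (rot m) a) q) = scal Q a (\<pi> q)"
    and pconj: "\<And>\<sigma> q. q \<in> carr Q \<Longrightarrow>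
      \<forall>\<^sub>F m in sequentially. \<pi> (act Q (rot m * \<sigma> * inverse (rot m)) q) = act Q \<sigma> (\<pi> q)"
    using contraction by (auto simp: contraction_def)
  have hc: "\<And>x. x \<in> C \<Longrightarrow> h x \<in> carr Q"
    and hadd: "\<And>x y. x \<in> C \<Longrightarrow> y \<in> C \<Longrightarrow> h (x + y) = h x + h y"
    and hscal: "\<And>a x. x \<in> C \<Longrightarrow> h (scal B a x) = scal Q a (h x)"
    and hact: "\<And>\<sigma> x. x \<in> C \<Longrightarrow> \<sigma> \<in> fixing (Suc N) \<Longrightarrow> h (act B \<sigma> x) = act Q \<sigma> (h x)"
    and hg: "\<And>x. x \<in> A \<Longrightarrow> h x = g x"
    using h by (auto simp: extension_def)
  note happens = eventually_happens'[OF sequentially_bot]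
  have ev_y: "\<forall>\<^sub>F m in sequentially. y x = act B (inverse (rot N) * rot m) x" if "x \<in> carr B" for x
    using B.eventually_shift[OF that] by eventually_elim (simp add: y_def B.act_mult that)
  have yC: "y x \<in> C" if "x \<in> C" for x
  proof -
    have "\<forall>\<^sub>F m in sequentially. y x \<in> C"
      using ev_y[OF subsetD[OF CB that]] eventually_ge_at_top[of N]
    proof eventually_elim
      case (elim m)
      have "inverse (rot N) * rot m \<in> fixing N"
        using elim by (simp add: fixing_def apply_times apply_inverse_rot apply_rot)
      then show ?case using elim Cact that by simp
    qed
    then show ?thesis using happens by blast
  qed
  have yB: "y x \<in> carr B" if "x \<in> carr B" for x
    using that happens[OF B.eventually_shift[OF that]] by (metis B.act_closed y_def)
  have zc: "act Q (rot N) (h (y x)) \<in> carr Q" if "x \<in> C" for x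
    using yC hc Q.act_closed that by blast
  show "extension N C h'"
    unfolding extension_def
  proof (intro conjI ballI allI)
    fix x assume "x \<in> C"
    then show "h' x \<in> carr Q" unfolding h'_def using zc pc by blast
  next
    fix x x' assume x: "x \<in> C" "x' \<in> C"
    then have xB: "x \<in> carr B" "x' \<in> carr B" "x + x' \<in> carr B"
      using CB B.subspace_add[OF B.subspace_carr] by blast+
    have "\<forall>\<^sub>F m in sequentially. y (x + x') = y x + y x'"
      using ev_y[OF xB(1)] ev_y[OF xB(2)] ev_y[OF xB(3)]
      by eventually_elim (simp add: B.act_add xB)
    then have "y (x + x') = y x + y x'" using happens by blast
    then show "h' (x + x') = h' x + h' x'"
      unfolding h'_def using x zc by (simp add: hadd yC hc Q.act_add padd)
  next
    fix a x assume x: "x \<in> C"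
    then have xB: "x \<in> carr B" "scal B a x \<in> carr B"
      using CB B.subspace_scale[OF B.subspace_carr] by blast+
    have "\<forall>\<^sub>F m in sequentially. h' (scal B a x) = scal Q a (h' x)"
      using ev_y[OF xB(1)] ev_y[OF xB(2)] pscal[OF zc[OF x], of a]
    proof eventually_elim
      case (elim m)
      have "y (scal B a x) = scal B (permute_rat (inverse (rot N)) (permute_rat (rot m) a)) (y x)"
        using elim(1,2) xB by (simp add: B.act_scal permute_rat_compose)
      then show ?case
        unfolding h'_def using elim(3) x by (simp add: hscal yC Q.act_scal hc)
    qed
    then show "h' (scal B a x) = scal Q a (h' x)" using happens by blast
  next
    fix \<sigma> x assume \<sigma>: "\<sigma> \<in> fixing N" and x: "x \<in> C"
    then have xB: "x \<in> carr B" "act B \<sigma> x \<in> carr B" using CB B.act_closed by blast+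
    obtain n where n: "\<forall>i\<ge>n. \<sigma> \<langle>$\<rangle> i = i" using perm_bounded by blast
    have "\<forall>\<^sub>F m in sequentially. h' (act B \<sigma> x) = act Q \<sigma> (h' x)"
      using ev_y[OF xB(1)] ev_y[OF xB(2)] pconj[OF zc[OF x], of \<sigma>] eventually_ge_at_top[of n]
    proof eventually_elim
      case (elim m)
      let ?\<tau> = "rot m * \<sigma> * inverse (rot m)"
      \<comment> \<open>This is \<sigma> conjugated by the partial shift in \<open>y\<close>. It
        fixes \<open>N\<close> as well as the smaller indices, because that shift misses
        \<open>N\<close>; hence the equivariance of \<open>h\<close> under
        \<open>fixing (Suc N)\<close> applies.\<close>
      let ?\<rho> = "inverse (rot N) * ?\<tau> * rot N"
      have n': "\<forall>i\<ge>m. \<sigma> \<langle>$\<rangle> i = i" using n elim(4) by simp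
      have fix\<rho>: "?\<rho> \<in> fixing (Suc N)"
        unfolding fixing_def
      proof clarify
        fix i assume i: "i < Suc N"
        have *: "?\<rho> \<langle>$\<rangle> i = inverse (rot N) \<langle>$\<rangle> (?\<tau> \<langle>$\<rangle> (rot N \<langle>$\<rangle> i))"
          by (simp only: apply_times comp_apply)
        show "?\<rho> \<langle>$\<rangle> i = i"
        proof (cases "i < N")
          case True
          then show ?thesis
            unfolding * using \<sigma> apply_conj_rot(2)[OF n', of i]
            by (simp add: apply_rot apply_inverse_rot fixing_def)
        next
          case False
          then have "i = N" using i by simp
          then show ?thesis
            unfolding * using apply_conj_rot(1)[OF n']
            by (simp add: apply_rot apply_inverse_rot)
        qed
      qed
      have "inverse (rot N) * rot m * \<sigma> = ?\<rho> * (inverse (rot N) * rot m)"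
        by (simp add: perm_eq_iff apply_times)
      then have "y (act B \<sigma> x) = act B ?\<rho> (y x)"
        using elim(1,2) xB(1) by (simp only: flip: B.act_mult)
      then have "h (y (act B \<sigma> x)) = act Q ?\<rho> (h (y x))"
        using hact[OF yC[OF x] fix\<rho>] by simp
      moreover have "rot N * ?\<rho> = ?\<tau> * rot N"
        by (simp add: perm_eq_iff apply_times)
      ultimately have "act Q (rot N) (h (y (act B \<sigma> x))) = act Q ?\<tau> (act Q (rot N) (h (y x)))"
        using hc[OF yC[OF x]] by (simp only: flip: Q.act_mult)
      then show ?case
        unfolding h'_def using elim(3) by simp
    qed
    then show "h' (act B \<sigma> x) = act Q \<sigma> (h' x)" using happens by blast
  next
    fix x assume x: "x \<in> A"
    then have xB: "x \<in> carr B" using A_carr by blast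
    have "\<forall>\<^sub>F m in sequentially. h' x = g x"
      using ev_y[OF xB] prot[OF g_carr[OF x]]
    proof eventually_elim
      case (elim m)
      \<comment> \<open>On \<open>A\<close> the given map is equivariant under all permutations, so
        \<open>rot N\<close> and its inverse cancel and \<pi> undoes \<open>rot m\<close>.\<close>
      have "h (y x) = act Q (inverse (rot N) * rot m) (g x)"
        unfolding elim(1) using hg[OF A_act[OF x]] g_act[OF x] by simp
      then have "act Q (rot N) (h (y x)) = act Q (rot N * (inverse (rot N) * rot m)) (g x)"
        using g_carr[OF x] by (simp only: flip: Q.act_mult)
      also have "rot N * (inverse (rot N) * rot m) = rot m"
        by (simp add: perm_eq_iff apply_times)
      finally show ?case unfolding h'_def using elim(2) by simp
    qed
    then show "h' x = g x" using happens by blast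
  qed
qed

lemma stable_mono: "stable N C \<Longrightarrow> N \<le> N' \<Longrightarrow> stable N' C"
  unfolding stable_def using fixing_le by blast

lemma extension_descend:
  assumes "stable N C" "extension N' C h" "N \<le> N'"
  shows "\<exists>h'. extension N C h'"
  using assms(3,2)
proof (induction N' arbitrary: h rule: dec_induct)
  case (step n)
  then show ?case using extension_step stable_mono[OF assms(1)] by blast
qed blast

lemma extension_subset: "extension N C h \<Longrightarrow> C' \<subseteq> C \<Longrightarrow> extension N C' h"
  unfolding extension_def by blast

text \<open>The new map is \<open>h\<close> after the projection onto \<open>D\<close> along the
  span of \<open>Z\<close>, that is, extension by zero. The projection commutes with
  \<open>fixing N\<close> because both summands are stable.\<close>

lemma extension_complement:
  assumes D: "stable N D" and h: "extension N D h"
    and Z: "Z \<subseteq> carr B" "\<And>\<sigma> z. \<sigma> \<in> fixing N \<Longrightarrow> z \<in> Z \<Longrightarrow> act B \<sigma> z \<in> B.span Z"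
    and disj: "D \<inter> B.span Z = {0}"
  shows "\<exists>h'. extension N (B.span (D \<union> Z)) h'"
proof
  have sub: "B.subspace D" and AD: "A \<subseteq> D" and DB: "D \<subseteq> carr B"
    and Dact: "\<And>\<sigma> x. \<sigma> \<in> fixing N \<Longrightarrow> x \<in> D \<Longrightarrow> act B \<sigma> x \<in> D"
    using D by (auto simp: stable_def)
  have ZB: "B.span Z \<subseteq> carr B" using Z(1) by (rule B.span_carr)
  have Zact: "act B \<sigma> z \<in> B.span Z" if "\<sigma> \<in> fixing N" "z \<in> B.span Z" for \<sigma> z
    using B.act_span_closed[OF that(2) Z(1)] Z(2) that(1) by blast
  define p where "p x = (THE d. d \<in> D \<and> x - d \<in> B.span Z)" for x
  have p: "p x = d" if "d \<in> D" "x - d \<in> B.span Z" for x d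
    unfolding p_def
  proof (rule the_equality)
    fix d' assume d': "d' \<in> D \<and> x - d' \<in> B.span Z"
    have "d - d' \<in> D" using B.subspace_diff[OF sub] that d' by blast
    moreover have "(x - d') - (x - d) \<in> B.span Z" using that d' B.span_diff by blast
    then have "d - d' \<in> B.span Z" by simp
    ultimately have "d - d' = 0" using disj by blast
    then show "d' = d" by simp
  qed (use that in auto)
  have ex: "p x \<in> D \<and> x - p x \<in> B.span Z" if x: "x \<in> B.span (D \<union> Z)" for x
  proof -
    obtain d z where "x = d + z" "d \<in> D" "z \<in> B.span Z"
      using x sub unfolding B.span_Un by (auto simp: B.span_eq_iff[THEN iffD2])
    then show ?thesis using p[of d x] by simp
  qed
  have span_D: "x \<in> carr B" if "x \<in> B.span (D \<union> Z)" for x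
    using that B.span_carr[of "D \<union> Z"] DB Z(1) by blast
  show "extension N (B.span (D \<union> Z)) (\<lambda>x. h (p x))"
    unfolding extension_def
  proof (intro conjI ballI allI)
    fix x assume "x \<in> B.span (D \<union> Z)"
    then show "h (p x) \<in> carr Q" using ex h by (auto simp: extension_def)
  next
    fix x y assume "x \<in> B.span (D \<union> Z)" "y \<in> B.span (D \<union> Z)"
    note x = ex[OF this(1)] and y = ex[OF this(2)]
    have "(x - p x) + (y - p y) \<in> B.span Z" using x y B.span_add by blast
    then have "p (x + y) = p x + p y"
      using x y B.subspace_add[OF sub] by (intro p) (auto simp: algebra_simps)
    then show "h (p (x + y)) = h (p x) + h (p y)" using x y h by (simp add: extension_def)
  next
    fix a x assume "x \<in> B.span (D \<union> Z)"
    note x = ex[OF this]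
    have "scal B a (x - p x) \<in> B.span Z" using x B.span_scale by blast
    then have "p (scal B a x) = scal B a (p x)"
      using x B.subspace_scale[OF sub] by (intro p) (auto simp: B.scale_right_diff_distrib)
    then show "h (p (scal B a x)) = scal Q a (h (p x))" using x h by (simp add: extension_def)
  next
    fix \<sigma> x assume \<sigma>: "\<sigma> \<in> fixing N" and "x \<in> B.span (D \<union> Z)"
    note x = ex[OF this(2)] and xB = span_D[OF this(2)]
    have "act B \<sigma> (x - p x) \<in> B.span Z" using x \<sigma> Zact by blast
    moreover have "act B \<sigma> (x - p x + p x) = act B \<sigma> (x - p x) + act B \<sigma> (p x)"
      using x ZB DB by (intro B.act_add) auto
    ultimately have "act B \<sigma> x - act B \<sigma> (p x) \<in> B.span Z" by simp
    then have "p (act B \<sigma> x) = act B \<sigma> (p x)" using x \<sigma> Dact by (intro p) auto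
    then show "h (p (act B \<sigma> x)) = act Q \<sigma> (h (p x))" using x h \<sigma> by (simp add: extension_def)
  next
    fix x assume "x \<in> A"
    then show "h (p x) = g x"
      using p[of x x] AD h by (auto simp: extension_def B.span_zero)
  qed
qed

end

section \<open>Symmetric vectors\<close>

definition var :: "nat \<Rightarrow> 'k::field ratfun" where
  "var i = Fraction_Field.Fract (Poly_Mapping.single (Poly_Mapping.single i 1) 1) 1"

lemma permute_rat_var: "permute_rat \<sigma> (var i) = var (\<sigma> \<langle>$\<rangle> i)"
proof -
  have "permute_mon \<sigma> (Poly_Mapping.single i 1) = Poly_Mapping.single (\<sigma> \<langle>$\<rangle> i) 1"
    by (rule poly_mapping_eqI) (auto simp: lookup_single when_def apply_inverse_eq_iff)
  then show ?thesis by (simp add: var_def permute_rat_Fract permute_poly_single)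
qed

lemma var_eq_iff [simp]: "(var i :: 'k::field ratfun) = var j \<longleftrightarrow> i = j"
proof
  let ?s = "\<lambda>i. Poly_Mapping.single i (1::nat)"
  assume "(var i :: 'k ratfun) = var j"
  then have "Poly_Mapping.single (?s i) (1::'k) = Poly_Mapping.single (?s j) 1"
    by (simp add: var_def eq_fract)
  then have "Poly_Mapping.lookup (Poly_Mapping.single (?s j) (1::'k)) (?s i) = 1"
    by (metis lookup_single_eq)
  then have "?s i = ?s j" by (simp add: lookup_single when_def split: if_splits)
  then have "Poly_Mapping.lookup (?s j) i = 1" by (metis lookup_single_eq)
  then show "i = j" by (simp add: lookup_single when_def split: if_splits)
qed simp

text \<open>Dedekind's elimination with vector coefficients, modulo the subspace \<open>U\<close>:
  the relations at \<open>b * b0\<close> and at \<open>b\<close> combine so that the term of one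
  character cancels. The scalars tested range over a multiplicative monoid \<open>E\<close> that
  separates the characters.\<close>

lemma (in vector_space) dedekind_independence:
  assumes "finite F" "subspace U"
    and one: "1 \<in> E" and times: "\<And>a b. a \<in> E \<Longrightarrow> b \<in> E \<Longrightarrow> a * b \<in> E"
    and hom: "\<And>i a b. \<chi> i (a * b) = \<chi> i a * \<chi> i b" "\<And>i. \<chi> i 1 = 1"
    and sep: "\<And>i j. i \<in> F \<Longrightarrow> j \<in> F \<Longrightarrow> i \<noteq> j \<Longrightarrow> \<exists>b\<in>E. \<chi> i b \<noteq> \<chi> j b"
    and rel: "\<And>b. b \<in> E \<Longrightarrow> (\<Sum>i\<in>F. scale (\<chi> i b) (x i)) \<in> U"
    and "i \<in> F"
  shows "x i \<in> U"
  using assms(1) sep rel \<open>i \<in> F\<close>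
proof (induction F arbitrary: x i rule: finite_induct)
  case (insert h F)
  have F: "x j \<in> U" if j: "j \<in> F" for j
  proof -
    have "j \<noteq> h" using j insert.hyps by blast
    then obtain b0 where b0: "b0 \<in> E" "\<chi> j b0 \<noteq> \<chi> h b0"
      using insert.prems(1)[of j h] j by blast
    have "scale (\<chi> j b0 - \<chi> h b0) (x j) \<in> U"
    proof (rule insert.IH[where x = "\<lambda>i. scale (\<chi> i b0 - \<chi> h b0) (x i)", OF _ _ j])
      fix b assume b: "b \<in> E"
      have "(\<Sum>i\<in>F. scale (\<chi> i b) (scale (\<chi> i b0 - \<chi> h b0) (x i)))
          = (\<Sum>i\<in>insert h F. scale (\<chi> i (b * b0)) (x i)) - scale (\<chi> h b0) (\<Sum>i\<in>insert h F. scale (\<chi> i b) (x i))"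
        using insert.hyps
        by (simp add: hom scale_right_distrib scale_sum_right sum_subtractf scale_left_diff_distrib
            scale_right_diff_distrib mult.commute)
      also have "\<dots> \<in> U"
        using insert.prems(2)[OF times[OF b b0(1)]] insert.prems(2)[OF b] assms(2)
        by (intro subspace_diff subspace_scale)
      finally show "(\<Sum>i\<in>F. scale (\<chi> i b) (scale (\<chi> i b0 - \<chi> h b0) (x i))) \<in> U" .
    qed (use insert.prems(1) in blast)
    then have "scale (inverse (\<chi> j b0 - \<chi> h b0)) (scale (\<chi> j b0 - \<chi> h b0) (x j)) \<in> U"
      using assms(2) by (rule subspace_scale[rotated])
    then show ?thesis using b0 by simp
  qed
  \<comment> \<open>At the scalar 1 all characters take the value 1. The terms from \<open>F\<close>
    are already in \<open>U\<close>, so the remaining one is too.\<close>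
  have "(\<Sum>i\<in>insert h F. x i) \<in> U"
    using insert.prems(2)[OF one] by (simp add: hom)
  then have "x h + (\<Sum>i\<in>F. x i) \<in> U" using insert.hyps by simp
  moreover have "(\<Sum>i\<in>F. x i) \<in> U" using F assms(2) by (intro subspace_sum) auto
  ultimately have "x h \<in> U" using assms(2) subspace_diff by fastforce
  then show ?case using F insert.prems(3) by blast
qed simp

lemma finite_perms: "finite {\<sigma> :: nat perm. \<forall>i\<ge>M. \<sigma> \<langle>$\<rangle> i = i}"
proof (rule inj_on_finite)
  show "inj_on (apply :: nat perm \<Rightarrow> _) {\<sigma>. \<forall>i\<ge>M. \<sigma> \<langle>$\<rangle> i = i}"
    by (rule inj_onI) (rule perm_eqI, simp)
  show "apply ` {\<sigma> :: nat perm. \<forall>i\<ge>M. \<sigma> \<langle>$\<rangle> i = i} \<subseteq> {p. p permutes {..<M}}"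
    by (auto simp: permutes_def not_less) (metis apply_inverse_apply)+
  show "finite {p. p permutes {..<M}}" by (simp add: finite_permutations)
qed

context smooth_rep
begin

text \<open>
  Invariance under the permutations of the block \<open>{N..<N+n}\<close> makes the translate of \<open>w\<close> by
  \<open>\<sigma> \<in> fixing N\<close> depend only on the image of that block.
\<close>

definition symmetric :: "nat \<Rightarrow> nat \<Rightarrow> 'm \<Rightarrow> bool" where
  "symmetric N n w \<longleftrightarrow> w \<in> carr M \<and>
     (\<forall>\<sigma>\<in>fixing N. apply \<sigma> ` {N..<N+n} = {N..<N+n} \<longrightarrow> act M \<sigma> w = w)"

lemma symmetric_carr: "symmetric N n w \<Longrightarrow> w \<in> carr M"
  by (simp add: symmetric_def)

lemma symmetric_invariant:
  assumes "symmetric N n w"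
  shows "invariant (N + n) w"
  unfolding invariant_def
proof
  fix \<sigma> assume \<sigma>: "\<sigma> \<in> fixing (N + n)"
  then have "apply \<sigma> ` {N..<N+n} = {N..<N+n}" by (auto simp: fixing_def image_def)
  then show "act M \<sigma> w = w"
    using assms \<sigma> fixing_le[of \<sigma> "N + n" N] by (simp add: symmetric_def)
qed

lemma symmetric_act_eq:
  assumes w: "symmetric N n w" and \<sigma>: "\<sigma> \<in> fixing N" "\<tau> \<in> fixing N"
    and eq: "apply \<sigma> ` {N..<N+n} = apply \<tau> ` {N..<N+n}"
  shows "act M \<sigma> w = act M \<tau> w"
proof -
  have "apply (inverse \<tau> * \<sigma>) ` {N..<N+n} = apply (inverse \<tau>) ` (apply \<tau> ` {N..<N+n})"
    unfolding eq[symmetric] by (simp add: image_image apply_times)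
  also have "\<dots> = {N..<N+n}" by (simp add: image_image)
  finally have "act M (inverse \<tau> * \<sigma>) w = w"
    using w \<sigma> by (simp add: symmetric_def fixing_mult)
  then show ?thesis
    using symmetric_carr[OF w] by (metis act_closed act_inverse(2) act_mult)
qed

text \<open>A translate depends only on the image of the block, and \<open>{..<P}\<close> has
  finitely many subsets.\<close>

lemma finite_symmetric_orbit:
  assumes w: "symmetric N n w"
  shows "finite {act M \<sigma> w | \<sigma>. \<sigma> \<in> fixing N \<and> apply \<sigma> ` {N..<N+n} \<subseteq> {..<P}}"
proof (rule finite_subset)
  let ?f = "\<lambda>S. act M (SOME \<sigma>. \<sigma> \<in> fixing N \<and> apply \<sigma> ` {N..<N+n} = S) w"
  show "{act M \<sigma> w | \<sigma>. \<sigma> \<in> fixing N \<and> apply \<sigma> ` {N..<N+n} \<subseteq> {..<P}} \<subseteq> ?f ` Pow {..<P}"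
  proof clarify
    fix \<sigma> assume \<sigma>: "\<sigma> \<in> fixing N" "apply \<sigma> ` {N..<N+n} \<subseteq> {..<P}"
    let ?\<tau> = "SOME \<tau>. \<tau> \<in> fixing N \<and> apply \<tau> ` {N..<N+n} = apply \<sigma> ` {N..<N+n}"
    have "?\<tau> \<in> fixing N \<and> apply ?\<tau> ` {N..<N+n} = apply \<sigma> ` {N..<N+n}"
      by (rule someI[of _ \<sigma>]) (simp add: \<sigma>)
    then have "act M \<sigma> w = ?f (apply \<sigma> ` {N..<N+n})"
      using \<sigma> by (intro symmetric_act_eq[OF w]) auto
    then show "act M \<sigma> w \<in> ?f ` Pow {..<P}" using \<sigma>(2) by blast
  qed
qed simp

text \<open>Sums of translates of \<open>scal M b w\<close> over the permutations of the block are
  symmetric, and Dedekind's independence recovers \<open>w\<close> from these sums for varying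
  \<open>b\<close>. Nothing is divided by the group order, so the characteristic is
  arbitrary.\<close>

lemma span_symmetric:
  assumes w: "w \<in> carr M" "invariant (N + n) w"
  shows "\<exists>T. finite T \<and> (\<forall>t\<in>T. symmetric N n t) \<and> w \<in> span T"
proof -
  define F where "F = {\<sigma>\<in>fixing N. \<forall>i\<ge>N+n. \<sigma> \<langle>$\<rangle> i = i}"
  \<comment> \<open>Scalars in \<open>E\<close> keep \<open>scal M b w\<close> invariant under
    \<open>fixing (N + n)\<close>, and \<open>E\<close> contains the variables below
    \<open>N + n\<close>, which tell the elements of \<open>F\<close> apart.\<close>
  define E where "E = {b :: 'k ratfun. \<forall>\<sigma>\<in>fixing (N + n). permute_rat \<sigma> b = b}"
  define t where "t b = (\<Sum>\<sigma>\<in>F. act M \<sigma> (scal M b w))" for b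
  have finF: "finite F" unfolding F_def by (rule finite_subset[OF _ finite_perms]) auto
  have F_less: "\<sigma> \<langle>$\<rangle> i < N + n" if "\<sigma> \<in> F" "i < N + n" for \<sigma> i
  proof (rule ccontr)
    assume "\<not> \<sigma> \<langle>$\<rangle> i < N + n"
    then have "\<sigma> \<langle>$\<rangle> (\<sigma> \<langle>$\<rangle> i) = \<sigma> \<langle>$\<rangle> i" using that(1) by (simp add: F_def)
    then have "\<sigma> \<langle>$\<rangle> i = i" by (simp only: apply_inj)
    then show False using that(2) \<open>\<not> \<sigma> \<langle>$\<rangle> i < N + n\<close> by simp
  qed
  have F_mult: "\<sigma> * \<tau> \<in> F" if "\<sigma> \<in> F" "\<tau> \<in> F" for \<sigma> \<tau>
    using that by (simp add: F_def fixing_mult apply_times)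
  have F_inverse: "inverse \<sigma> \<in> F" if "\<sigma> \<in> F" for \<sigma>
    using that by (auto simp: F_def apply_inverse_eq_iff)
  have bw: "scal M b w \<in> carr M" for b
    using w subspace_scale[OF subspace_carr] by blast
  have "symmetric N n (t b)" if b: "b \<in> E" for b
    unfolding symmetric_def
  proof (intro conjI ballI impI)
    show tb: "t b \<in> carr M"
      unfolding t_def by (intro subspace_sum[OF subspace_carr] act_closed bw)
    fix \<tau> assume \<tau>: "\<tau> \<in> fixing N" "apply \<tau> ` {N..<N+n} = {N..<N+n}"
    have inv: "invariant (N + n) (act M \<sigma> (scal M b w))" if "\<sigma> \<in> F" for \<sigma>
    proof (rule invariant_act[OF bw])
      show "invariant (N + n) (scal M b w)"
        using w b by (simp add: invariant_def act_scal E_def)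
    qed (use that F_less in auto)
    have "invariant (N + n) (t b)"
      unfolding invariant_def t_def
      using inv by (simp add: act_sum act_closed bw) (simp add: invariant_def)
    \<comment> \<open>\<tau> may also move indices beyond the block. Its replacement agrees with it
      below \<open>N + n\<close> and lies in \<open>F\<close>, which suffices on an invariant
      vector.\<close>
    obtain \<tau>' where \<tau>': "\<forall>i\<in>{..<N+n}. \<tau>' \<langle>$\<rangle> i = \<tau> \<langle>$\<rangle> i"
      "\<forall>i. i \<notin> {..<N+n} \<union> apply \<tau> ` {..<N+n} \<longrightarrow> \<tau>' \<langle>$\<rangle> i = i"
      using extend_to_perm[of "{..<N+n}" "apply \<tau>"] by (auto simp: inj_on_subset[OF inj_apply])
    have "\<tau> \<langle>$\<rangle> i < N + n" if "i < N + n" for i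
      using that \<tau> by (cases "i < N") (auto simp: fixing_def)
    then have "i \<notin> {..<N+n} \<union> apply \<tau> ` {..<N+n}" if "N + n \<le> i" for i
      using that by force
    then have \<tau>'F: "\<tau>' \<in> F"
      using \<tau> \<tau>' by (simp add: F_def fixing_def)
    have "act M \<tau> (t b) = act M \<tau>' (t b)"
      using \<open>invariant (N + n) (t b)\<close> \<tau>'(1) by (intro act_agree[OF tb]) auto
    also have "\<dots> = (\<Sum>\<sigma>\<in>F. act M (\<tau>' * \<sigma>) (scal M b w))"
      unfolding t_def by (simp add: act_sum act_closed bw act_mult)
    also have "\<dots> = t b"
      unfolding t_def
      by (rule sum.reindex_bij_witness[where i = "\<lambda>\<sigma>. inverse \<tau>' * \<sigma>" and j = "\<lambda>\<sigma>. \<tau>' * \<sigma>"])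
        (simp_all add: F_mult F_inverse \<tau>'F flip: mult.assoc)
    finally show "act M \<tau> (t b) = t b" .
  qed
  \<comment> \<open>\<open>w\<close> is the member at the identity of the family of translates
    indexed by \<open>F\<close>.\<close>
  moreover have "act M 1 w \<in> span (t ` E)"
  proof (rule dedekind_independence[where F = F and E = E and \<chi> = permute_rat and x = "\<lambda>\<sigma>. act M \<sigma> w"])
    fix \<sigma> \<tau> assume \<sigma>: "\<sigma> \<in> F" "\<tau> \<in> F" "\<sigma> \<noteq> \<tau>"
    then obtain i where i: "\<sigma> \<langle>$\<rangle> i \<noteq> \<tau> \<langle>$\<rangle> i" by (auto simp: perm_eq_iff)
    then have "i < N + n" using \<sigma> by (force simp: F_def not_le[symmetric])
    then have "var i \<in> E" by (simp add: E_def permute_rat_var fixing_def)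
    then show "\<exists>b\<in>E. permute_rat \<sigma> b \<noteq> permute_rat \<tau> b"
      using i by (intro bexI[of _ "var i"]) (simp_all add: permute_rat_var)
  next
    fix b assume "b \<in> E"
    then have "t b \<in> span (t ` E)" by (intro span_base imageI)
    then show "(\<Sum>\<sigma>\<in>F. scal M (permute_rat \<sigma> b) (act M \<sigma> w)) \<in> span (t ` E)"
      using w by (simp add: t_def act_scal)
  qed (simp_all add: finF E_def permute_rat_mult, simp add: F_def)
  then have "w \<in> span (t ` E)" using w by (simp add: act_one)
  then obtain T r where T: "finite T" "T \<subseteq> t ` E" "w = (\<Sum>a\<in>T. scal M (r a) a)"
    unfolding span_explicit by blast
  then have "w \<in> span T" by (simp only:) (intro span_sum span_scale span_base)
  ultimately show ?thesis using T by blast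
qed

end

section \<open>Extension to finitely generated subrepresentations\<close>

text \<open>\<open>L\<close> is packed into the first places from \<open>N\<close> on, and
  \<open>S\<close> is pushed beyond them. This isolates one index set of a relation from the indices
  of the others.\<close>

lemma exists_perm_separating:
  fixes L S :: "nat set"
  assumes "finite L" "finite S" "L \<inter> S = {}" "\<And>i. i \<in> L \<union> S \<Longrightarrow> N \<le> i"
  shows "\<exists>\<tau>\<in>fixing N. \<exists>N'\<ge>N. (\<forall>i\<in>L. \<tau> \<langle>$\<rangle> i < N') \<and> (\<forall>i\<in>S. N' \<le> \<tau> \<langle>$\<rangle> i)"
proof -
  let ?N' = "N + card L"
  obtain e where e: "bij_betw e L {N..<?N'}"
    using assms(1) by (metis finite_same_card_bij card_atLeastLessThan diff_add_inverse finite_atLeastLessThan)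
  define f where "f i = (if i < N then i else if i \<in> L then e i else i + ?N')" for i
  have e_range: "N \<le> e i \<and> e i < ?N'" if "i \<in> L" for i
    using bij_betwE[OF e] that by auto
  have e_inj: "e i = e j \<longleftrightarrow> i = j" if "i \<in> L" "j \<in> L" for i j
    using e that by (auto simp: bij_betw_def inj_on_def)
  have "inj_on f ({..<N} \<union> L \<union> S)"
    by (rule inj_onI) (use e_range e_inj in \<open>force simp: f_def split: if_splits\<close>)
  then obtain \<tau> :: "nat perm" where \<tau>: "\<And>i. i \<in> {..<N} \<union> L \<union> S \<Longrightarrow> \<tau> \<langle>$\<rangle> i = f i"
    using extend_to_perm[of "{..<N} \<union> L \<union> S" f] assms(1,2) by auto
  have "\<tau> \<in> fixing N" using \<tau> by (simp add: fixing_def f_def)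
  moreover have "\<tau> \<langle>$\<rangle> i < ?N'" if "i \<in> L" for i
    using \<tau>[of i] assms(4)[of i] e_range[of i] that by (simp add: f_def)
  moreover have "?N' \<le> \<tau> \<langle>$\<rangle> i" if "i \<in> S" for i
  proof -
    have "i \<notin> L" "N \<le> i" using assms(3,4) that by auto
    then show ?thesis using \<tau>[of i] that by (simp add: f_def)
  qed
  ultimately show ?thesis by (intro bexI[of _ \<tau>] exI[of _ ?N']) auto
qed

lemma fixing_apply_ge:
  assumes "\<sigma> \<in> fixing N" "N \<le> i"
  shows "N \<le> \<sigma> \<langle>$\<rangle> i"
proof (rule ccontr)
  assume *: "\<not> N \<le> \<sigma> \<langle>$\<rangle> i"
  then have "\<sigma> \<langle>$\<rangle> (\<sigma> \<langle>$\<rangle> i) = \<sigma> \<langle>$\<rangle> i" using assms(1) by (simp add: fixing_def)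
  then have "\<sigma> \<langle>$\<rangle> i = i" by (simp only: apply_inj)
  then show False using assms(2) * by simp
qed

lemma fixing_apply_ge_disjoint:
  assumes "\<sigma> \<in> fixing N" "apply \<sigma> ` {N..<N+n} \<inter> {N..<N'} = {}" "i \<in> {N..<N+n}"
  shows "N' \<le> \<sigma> \<langle>$\<rangle> i"
proof -
  have "N \<le> \<sigma> \<langle>$\<rangle> i" using assms by (intro fixing_apply_ge) auto
  moreover have "\<sigma> \<langle>$\<rangle> i \<notin> {N..<N'}" using assms(2,3) by blast
  ultimately show ?thesis by simp
qed

text \<open>Both images of the block lie at or above \<open>N'\<close>, so carrying one to the other
  is compatible with fixing every index below \<open>N'\<close>.\<close>

lemma exists_perm_transport:
  assumes \<sigma>: "\<sigma> \<in> fixing N" "\<tau> \<in> fixing N" and N': "N \<le> N'"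
    and disj: "apply \<sigma> ` {N..<N+n} \<inter> {N..<N'} = {}" "apply \<tau> ` {N..<N+n} \<inter> {N..<N'} = {}"
  shows "\<exists>\<upsilon>\<in>fixing N'. \<forall>i<N+n. (\<upsilon> * \<sigma>) \<langle>$\<rangle> i = \<tau> \<langle>$\<rangle> i"
proof -
  note ge = fixing_apply_ge_disjoint
  let ?A = "{..<N'} \<union> apply \<sigma> ` {N..<N+n}"
  define f where "f i = (if i < N' then i else \<tau> \<langle>$\<rangle> (inverse \<sigma> \<langle>$\<rangle> i))" for i
  have "inj_on f ?A"
  proof (rule inj_onI)
    fix i j assume ij: "i \<in> ?A" "j \<in> ?A" "f i = f j"
    have big: "N' \<le> f i" if "i \<in> ?A" "\<not> i < N'" for i
      using that ge[OF \<sigma>(2) disj(2)] by (auto simp: f_def)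
    show "i = j"
    proof (cases "i < N' \<longleftrightarrow> j < N'")
      case True
      then show ?thesis using ij(3) by (auto simp: f_def apply_inj split: if_splits)
    next
      case False
      then show ?thesis using ij big[of i] big[of j] by (auto simp: f_def split: if_splits)
    qed
  qed
  then obtain \<upsilon> :: "nat perm" where \<upsilon>: "\<And>i. i \<in> ?A \<Longrightarrow> \<upsilon> \<langle>$\<rangle> i = f i"
    using extend_to_perm[of ?A f] by auto
  have "\<upsilon> \<in> fixing N'" using \<upsilon> by (simp add: fixing_def f_def)
  moreover have "(\<upsilon> * \<sigma>) \<langle>$\<rangle> i = \<tau> \<langle>$\<rangle> i" if "i < N + n" for i
  proof (cases "i < N")
    case True
    then show ?thesis using \<sigma> \<upsilon>[of i] N' by (simp add: apply_times fixing_def f_def)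
  next
    case False
    then have i: "i \<in> {N..<N+n}" using that by simp
    then have "\<not> \<sigma> \<langle>$\<rangle> i < N'" using ge[OF \<sigma>(1) disj(1) i] by simp
    then show ?thesis using \<upsilon>[of "\<sigma> \<langle>$\<rangle> i"] i by (simp add: apply_times f_def)
  qed
  ultimately show ?thesis by blast
qed

section \<open>Induction on the degree of the generators\<close>

context extension_problem
begin

lemma stable_span:
  assumes "S \<subseteq> carr B" "\<And>\<sigma> s. \<sigma> \<in> fixing N \<Longrightarrow> s \<in> S \<Longrightarrow> act B \<sigma> s \<in> S"
  shows "stable N (B.span (A \<union> S))"
  unfolding stable_def
proof (intro conjI ballI)
  show "A \<subseteq> B.span (A \<union> S)" using B.span_superset[of "A \<union> S"] by blast
  have AS: "A \<union> S \<subseteq> carr B" using assms(1) A_carr by blast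
  then show "B.span (A \<union> S) \<subseteq> carr B" by (rule B.span_carr)
  fix \<sigma> x assume "\<sigma> \<in> fixing N" "x \<in> B.span (A \<union> S)"
  then show "act B \<sigma> x \<in> B.span (A \<union> S)"
    using AS assms(2) A_act by (intro B.act_span_closed[of x "A \<union> S"]) (auto intro: B.span_base)
qed simp

text \<open>
  From the point of view of \<^term>\<open>fixing N'\<close>, these translates have degree less than \<open>n\<close>: at
  least one of their \<open>n\<close> indices is no longer moved.
\<close>

definition meeting :: "nat \<Rightarrow> nat \<Rightarrow> 'b set \<Rightarrow> nat \<Rightarrow> 'b set" where
  "meeting N n W N' = {act B \<sigma> w | \<sigma> w. \<sigma> \<in> fixing N \<and> w \<in> W \<and> apply \<sigma> ` {N..<N+n} \<inter> {N..<N'} \<noteq> {}}"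

text \<open>For suitable \<open>N'\<close>, the translates decompose into those of lower degree,
  handled by \<open>lower\<close>, and those of a minimal generating subset away from
  \<open>{N..<N'}\<close>, which span a complement. There the map is extended by zero, and finally
  \<open>N'\<close> is lowered to \<open>N\<close>.\<close>

lemma extension_symmetric:
  assumes W: "finite W" "\<And>w. w \<in> W \<Longrightarrow> B.symmetric N n w"
    and lower: "\<And>N'. N \<le> N' \<Longrightarrow> \<exists>h. extension N' (B.span (A \<union> meeting N n W N')) h"
  shows "\<exists>h. extension N (B.span (A \<union> {act B \<sigma> w | \<sigma> w. \<sigma> \<in> fixing N \<and> w \<in> W})) h"
proof -
  let ?I = "{N..<N+n}"
  define D where "D N' = B.span (A \<union> meeting N n W N')" for N'
  have WB: "w \<in> carr B" if "w \<in> W" for w using W(2)[OF that] by (rule B.symmetric_carr)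
  have D_stable: "stable N' (D N')" if "N \<le> N'" for N'
    unfolding D_def
  proof (rule stable_span)
    show "meeting N n W N' \<subseteq> carr B" unfolding meeting_def using WB B.act_closed by blast
    fix \<tau> s assume \<tau>: "\<tau> \<in> fixing N'" and "s \<in> meeting N n W N'"
    then obtain \<sigma> w where s': "s = act B \<sigma> w" "\<sigma> \<in> fixing N" "w \<in> W" "apply \<sigma> ` ?I \<inter> {N..<N'} \<noteq> {}"
      unfolding meeting_def by blast
    then obtain i where "i \<in> ?I" "\<sigma> \<langle>$\<rangle> i \<in> {N..<N'}" by blast
    note s = s'(1-3) this
    then have "(\<tau> * \<sigma>) \<langle>$\<rangle> i \<in> {N..<N'}" using \<tau> by (simp add: apply_times fixing_def)
    then have "apply (\<tau> * \<sigma>) ` ?I \<inter> {N..<N'} \<noteq> {}" using s(4) by blast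
    moreover have "act B \<tau> s = act B (\<tau> * \<sigma>) w" using s WB by (simp add: B.act_mult)
    moreover have "\<tau> * \<sigma> \<in> fixing N" using s \<tau> that fixing_le fixing_mult by blast
    ultimately show "act B \<tau> s \<in> meeting N n W N'" unfolding meeting_def using s(3) by blast
  qed
  have D_mono: "D N' \<subseteq> D N''" if "N' \<le> N''" for N' N''
  proof -
    have "{N..<N'} \<subseteq> {N..<N''}" using that by auto
    then show ?thesis unfolding D_def meeting_def by (intro B.span_mono) blast
  qed
  have D_carr: "D N' \<subseteq> carr B" and D_sub: "B.subspace (D N')" if "N \<le> N'" for N'
    using D_stable[OF that] by (auto simp: stable_def)
  have D_act: "act B \<sigma> x \<in> D N'" if "N \<le> N'" "\<sigma> \<in> fixing N'" "x \<in> D N'" for N' \<sigma> x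
    using D_stable[OF that(1)] that by (auto simp: stable_def)
  \<comment> \<open>Modulo \<open>D N'\<close>, the translates of \<open>Y\<close> by one \<sigma>
    span the translates of \<open>W\<close> by the same \<sigma>. Keeping a single \<sigma> ties
    each relation to one index set, so that it can be transported to any other.\<close>
  define R where "R N' Y \<longleftrightarrow> (\<forall>\<sigma>\<in>fixing N. apply \<sigma> ` ?I \<inter> {N..<N'} = {} \<longrightarrow>
    (\<forall>w\<in>W. act B \<sigma> w \<in> B.span (D N' \<union> act B \<sigma> ` Y)))" for N' Y
  define P where "P k \<longleftrightarrow> (\<exists>N'\<ge>N. \<exists>Y\<subseteq>W. card Y = k \<and> R N' Y)" for k
  \<comment> \<open>For \<open>Y\<close> of minimal size over all \<open>N'\<close>, the translates of \<open>Y\<close> away from \<open>{N..<N'}\<close> are independent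
    modulo \<^term>\<open>D N'\<close>: a relation, moved so that all but one of its index sets meet
    \<open>{N'..<N''}\<close>, would express that last vector modulo \<^term>\<open>D N''\<close> and the rest of \<open>Y\<close>.\<close>
  have "R N W" unfolding R_def by (auto intro: B.span_base)
  then have "P (card W)" unfolding P_def by blast
  then obtain k where k: "P k" and min: "\<And>k'. P k' \<Longrightarrow> k \<le> k'"
    by (metis LeastI Least_le)
  obtain N' Y where N': "N \<le> N'" and Y: "Y \<subseteq> W" "card Y = k" and R: "R N' Y"
    using k unfolding P_def by blast
  have finY: "finite Y" using Y(1) W(1) by (rule finite_subset)
  define Z where "Z = {act B \<sigma> y | \<sigma> y. \<sigma> \<in> fixing N \<and> y \<in> Y \<and> apply \<sigma> ` ?I \<inter> {N..<N'} = {}}"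
  have ZB: "Z \<subseteq> carr B" unfolding Z_def using Y(1) WB B.act_closed by blast
  have Z_act: "act B \<tau> z \<in> Z" if \<tau>: "\<tau> \<in> fixing N'" and z: "z \<in> Z" for \<tau> z
  proof -
    obtain \<sigma> y where z: "z = act B \<sigma> y" "\<sigma> \<in> fixing N" "y \<in> Y" "apply \<sigma> ` ?I \<inter> {N..<N'} = {}"
      using z unfolding Z_def by blast
    have "apply (\<tau> * \<sigma>) ` ?I \<inter> {N..<N'} = {}"
    proof (rule ccontr)
      assume "apply (\<tau> * \<sigma>) ` ?I \<inter> {N..<N'} \<noteq> {}"
      then obtain i where i: "i \<in> ?I" "(\<tau> * \<sigma>) \<langle>$\<rangle> i \<in> {N..<N'}" by blast
      then have "\<tau> \<langle>$\<rangle> (\<tau> \<langle>$\<rangle> (\<sigma> \<langle>$\<rangle> i)) = \<tau> \<langle>$\<rangle> (\<sigma> \<langle>$\<rangle> i)"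
        using \<tau> by (simp add: fixing_def apply_times)
      then have "\<tau> \<langle>$\<rangle> (\<sigma> \<langle>$\<rangle> i) = \<sigma> \<langle>$\<rangle> i" by (simp only: apply_inj)
      then have "\<sigma> \<langle>$\<rangle> i \<in> {N..<N'}" using i(2) by (simp add: apply_times)
      then show False using i(1) z(4) by blast
    qed
    moreover have "act B \<tau> z = act B (\<tau> * \<sigma>) y" using z Y(1) WB by (simp add: B.act_mult subset_iff)
    moreover have "\<tau> * \<sigma> \<in> fixing N" using z \<tau> N' fixing_le fixing_mult by blast
    ultimately show ?thesis unfolding Z_def using z(3) by blast
  qed
  have disj: "D N' \<inter> B.span Z = {0}"
  proof (rule ccontr)
    assume "D N' \<inter> B.span Z \<noteq> {0}"
    moreover have "0 \<in> D N' \<inter> B.span Z" using D_sub[OF N'] B.subspace_0 B.span_zero by blast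
    ultimately obtain x where x: "x \<in> D N'" "x \<in> B.span Z" "x \<noteq> 0" by blast
    then obtain F a where F: "finite F" "F \<subseteq> Z" and xF: "x = (\<Sum>z\<in>F. scal B (a z) z)"
      unfolding B.span_explicit by blast
    obtain z0 where z0: "z0 \<in> F" "a z0 \<noteq> 0"
      using x(3) xF by (metis (no_types, lifting) B.scale_zero_left sum.neutral)
    obtain \<sigma>0 y0 where \<sigma>0: "z0 = act B \<sigma>0 y0" "\<sigma>0 \<in> fixing N" "y0 \<in> Y" "apply \<sigma>0 ` ?I \<inter> {N..<N'} = {}"
      using z0(1) F(2) unfolding Z_def by blast
    have "\<forall>z\<in>F. \<exists>\<sigma> y. z = act B \<sigma> y \<and> \<sigma> \<in> fixing N \<and> y \<in> Y \<and> apply \<sigma> ` ?I \<inter> {N..<N'} = {}"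
      using F(2) unfolding Z_def by blast
    then obtain s t where st: "\<And>z. z \<in> F \<Longrightarrow> z = act B (s z) (t z) \<and> s z \<in> fixing N \<and> t z \<in> Y \<and>
        apply (s z) ` ?I \<inter> {N..<N'} = {}"
      by metis
    \<comment> \<open>The indices of the relation outside the index set of \<open>z0\<close>. They
      are moved below \<open>N''\<close>, while the index set of \<open>z0\<close> is kept at or
      above \<open>N''\<close>.\<close>
    define L where "L = (\<Union>z\<in>F. apply (s z) ` ?I) - apply \<sigma>0 ` ?I"
    have "\<exists>\<tau>\<in>fixing N'. \<exists>N''\<ge>N'. (\<forall>i\<in>L. \<tau> \<langle>$\<rangle> i < N'') \<and> (\<forall>i\<in>apply \<sigma>0 ` ?I. N'' \<le> \<tau> \<langle>$\<rangle> i)"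
    proof (rule exists_perm_separating)
      fix i assume "i \<in> L \<union> apply \<sigma>0 ` ?I"
      then show "N' \<le> i" using fixing_apply_ge_disjoint \<sigma>0 st unfolding L_def by blast
    qed (auto simp: L_def F(1))
    then obtain \<tau> N'' where \<tau>: "\<tau> \<in> fixing N'" and N'': "N' \<le> N''"
      and \<tau>L: "\<And>i. i \<in> L \<Longrightarrow> \<tau> \<langle>$\<rangle> i < N''" and \<tau>0: "\<And>i. i \<in> ?I \<Longrightarrow> N'' \<le> \<tau> \<langle>$\<rangle> (\<sigma>0 \<langle>$\<rangle> i)"
      by blast
    have \<tau>N: "\<tau> \<in> fixing N" using \<tau> N' by (rule fixing_le)
    have NN'': "N \<le> N''" using N' N'' by simp
    let ?\<sigma>1 = "\<tau> * \<sigma>0"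
    have "?\<sigma>1 \<langle>$\<rangle> i \<notin> {N..<N''}" if "i \<in> ?I" for i
      using \<tau>0[OF that] by (simp add: apply_times)
    then have \<sigma>1: "?\<sigma>1 \<in> fixing N" "apply ?\<sigma>1 ` ?I \<inter> {N..<N''} = {}"
      using \<tau>N \<sigma>0(2) fixing_mult by blast+
    have YB: "y \<in> carr B" if "y \<in> Y" for y using that Y(1) WB by blast
    have z0_span: "z0 \<in> B.span (D N' \<union> (F - {z0}))"
    proof -
      have "x = scal B (a z0) z0 + (\<Sum>z\<in>F-{z0}. scal B (a z) z)"
        unfolding xF using F(1) z0(1) by (rule sum.remove)
      then have "scal B (a z0) z0 = x - (\<Sum>z\<in>F-{z0}. scal B (a z) z)" by simp
      also have "\<dots> \<in> B.span (D N' \<union> (F - {z0}))"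
        using x(1) by (intro B.span_diff B.span_sum B.span_scale B.span_base) auto
      finally have "scal B (inverse (a z0)) (scal B (a z0) z0) \<in> B.span (D N' \<union> (F - {z0}))"
        by (rule B.span_scale)
      then show ?thesis using z0(2) by simp
    qed
    have "act B \<tau> z0 \<in> B.span (D N'' \<union> act B ?\<sigma>1 ` (Y - {y0}))"
    proof (rule B.act_span_closed[OF z0_span])
      show "D N' \<union> (F - {z0}) \<subseteq> carr B" using D_carr[OF N'] F(2) ZB by blast
      fix v assume "v \<in> D N' \<union> (F - {z0})"
      then consider "v \<in> D N'" | "v \<in> F" "v \<noteq> z0" by blast
      then show "act B \<tau> v \<in> B.span (D N'' \<union> act B ?\<sigma>1 ` (Y - {y0}))"
      proof cases
        case 1
        then have "act B \<tau> v \<in> D N''" using D_act[OF N' \<tau>] D_mono[OF N''] by blast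
        then show ?thesis by (intro B.span_base) simp
      next
        case 2
        note v = st[OF 2(1)]
        have tW: "t v \<in> W" using v Y(1) by blast
        show ?thesis
        proof (cases "apply (s v) ` ?I = apply \<sigma>0 ` ?I")
          \<comment> \<open>Here \<open>v\<close> has the index set of \<open>z0\<close> but differs
            from it, so it comes from another member of \<open>Y\<close> by the same
            permutation.\<close>
          case True
          then have "v = act B \<sigma>0 (t v)"
            using v \<sigma>0(2) by (metis B.symmetric_act_eq W(2) tW)
          moreover from this have "t v \<noteq> y0" using 2(2) \<sigma>0(1) by blast
          moreover have "act B \<tau> (act B \<sigma>0 (t v)) = act B ?\<sigma>1 (t v)"
            using WB[OF tW] by (simp add: B.act_mult)
          ultimately have "act B \<tau> v \<in> act B ?\<sigma>1 ` (Y - {y0})"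
            using v by (metis DiffI image_eqI singletonD)
          then show ?thesis by (intro B.span_base) simp
        next
          case False
          \<comment> \<open>Distinct index sets of equal size are not nested, so the set of
            \<open>v\<close> has an index in \<open>L\<close>. That index ends up below
            \<open>N''\<close>, which puts the moved vector into \<open>D N''\<close>.\<close>
          have "card (apply (s v) ` ?I) = card (apply \<sigma>0 ` ?I)"
            by (simp add: card_image inj_on_subset[OF inj_apply])
          then have "\<not> apply (s v) ` ?I \<subseteq> apply \<sigma>0 ` ?I"
            using False by (metis card_subset_eq finite_atLeastLessThan finite_imageI)
          then obtain i where i: "i \<in> ?I" "s v \<langle>$\<rangle> i \<notin> apply \<sigma>0 ` ?I" by blast
          then have "s v \<langle>$\<rangle> i \<in> L" using 2(1) unfolding L_def by blast
          then have less: "\<tau> \<langle>$\<rangle> (s v \<langle>$\<rangle> i) < N''" by (rule \<tau>L)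
          have "\<tau> * s v \<in> fixing N" using \<tau>N v by (simp add: fixing_mult)
          then have "N \<le> (\<tau> * s v) \<langle>$\<rangle> i"
            using i(1) by (intro fixing_apply_ge) auto
          then have "(\<tau> * s v) \<langle>$\<rangle> i \<in> {N..<N''}" using less by (simp add: apply_times)
          then have "apply (\<tau> * s v) ` ?I \<inter> {N..<N''} \<noteq> {}" using i(1) by blast
          moreover have "act B \<tau> v = act B (\<tau> * s v) (t v)"
            using v WB[OF tW] by (metis B.act_mult)
          ultimately have "act B \<tau> v \<in> meeting N n W N''"
            unfolding meeting_def using \<open>\<tau> * s v \<in> fixing N\<close> tW by blast
          then have "act B \<tau> v \<in> D N''" unfolding D_def by (intro B.span_base) simp
          then show ?thesis by (intro B.span_base) simp
        qed
      qed
    qed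
    then have y0_span: "act B ?\<sigma>1 y0 \<in> B.span (D N'' \<union> act B ?\<sigma>1 ` (Y - {y0}))"
      using \<sigma>0(1,3) YB by (simp add: B.act_mult)
    have "R N'' (Y - {y0})"
      unfolding R_def
    proof (intro ballI impI)
      fix \<sigma> w assume \<sigma>: "\<sigma> \<in> fixing N" "apply \<sigma> ` ?I \<inter> {N..<N''} = {}" and w: "w \<in> W"
      \<comment> \<open>\<open>fixing N''\<close> acts transitively on the positions of the block
        avoiding \<open>{N..<N''}\<close>, so the one relation found at \<open>?\<sigma>1\<close>
        holds at every such \<sigma>.\<close>
      obtain \<upsilon> where \<upsilon>: "\<upsilon> \<in> fixing N''" "\<forall>i<N+n. (\<upsilon> * ?\<sigma>1) \<langle>$\<rangle> i = \<sigma> \<langle>$\<rangle> i"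
        using exists_perm_transport[OF \<sigma>1(1) \<sigma>(1) NN'' \<sigma>1(2) \<sigma>(2)] by blast
      have trans: "act B \<upsilon> (act B ?\<sigma>1 y) = act B \<sigma> y" if "y \<in> Y" for y
      proof -
        have y: "y \<in> W" using that Y(1) by blast
        have "act B (\<upsilon> * ?\<sigma>1) y = act B \<sigma> y"
          using \<upsilon>(2) by (intro B.act_agree[OF WB[OF y] B.symmetric_invariant[OF W(2)[OF y]]]) blast
        then show ?thesis using WB[OF y] by (simp add: B.act_mult)
      qed
      let ?T = "B.span (D N'' \<union> act B \<sigma> ` (Y - {y0}))"
      have "act B \<upsilon> (act B ?\<sigma>1 y0) \<in> ?T"
      proof (rule B.act_span_closed[OF y0_span])
        show "D N'' \<union> act B ?\<sigma>1 ` (Y - {y0}) \<subseteq> carr B"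
          using D_carr[OF NN''] YB B.act_closed by blast
        fix v assume "v \<in> D N'' \<union> act B ?\<sigma>1 ` (Y - {y0})"
        then have "act B \<upsilon> v \<in> D N'' \<union> act B \<sigma> ` (Y - {y0})"
          using D_act[OF NN'' \<upsilon>(1)] trans by auto
        then show "act B \<upsilon> v \<in> ?T" by (rule B.span_base)
      qed
      then have y0T: "act B \<sigma> y0 \<in> ?T" using trans[OF \<sigma>0(3)] by simp
      have "{N..<N'} \<subseteq> {N..<N''}" using N'' by auto
      then have "apply \<sigma> ` ?I \<inter> {N..<N'} = {}" using \<sigma>(2) by blast
      then have "act B \<sigma> w \<in> B.span (D N' \<union> act B \<sigma> ` Y)" using R \<sigma>(1) w unfolding R_def by blast
      also have "\<dots> \<subseteq> ?T"
      proof (rule B.span_minimal[OF _ B.subspace_span])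
        show "D N' \<union> act B \<sigma> ` Y \<subseteq> ?T"
          using y0T D_mono[OF N''] B.span_superset[of "D N'' \<union> act B \<sigma> ` (Y - {y0})"] by blast
      qed
      finally show "act B \<sigma> w \<in> ?T" .
    qed
    then have "P (card (Y - {y0}))" unfolding P_def using NN'' Y(1) by blast
    then have "card Y \<le> card (Y - {y0})" using min Y(2) by blast
    then show False using \<sigma>0(3) finY by (metis card_Diff1_less linorder_not_le)
  qed
  obtain h where "extension N' (D N') h" using lower[OF N'] unfolding D_def by blast
  then obtain h' where h': "extension N' (B.span (D N' \<union> Z)) h'"
    using extension_complement[OF D_stable[OF N'] _ ZB _ disj] Z_act B.span_base by blast
  let ?C = "B.span (A \<union> {act B \<sigma> w | \<sigma> w. \<sigma> \<in> fixing N \<and> w \<in> W})"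
  have "?C \<subseteq> B.span (D N' \<union> Z)"
  proof (rule B.span_minimal[OF _ B.subspace_span], rule subsetI)
    fix v assume "v \<in> A \<union> {act B \<sigma> w | \<sigma> w. \<sigma> \<in> fixing N \<and> w \<in> W}"
    then consider "v \<in> A" | \<sigma> w where "v = act B \<sigma> w" "\<sigma> \<in> fixing N" "w \<in> W" by blast
    then show "v \<in> B.span (D N' \<union> Z)"
    proof cases
      case 1
      then have "v \<in> D N'" unfolding D_def by (intro B.span_base) simp
      then show ?thesis by (intro B.span_base) simp
    next
      case 2
      show ?thesis
      proof (cases "apply \<sigma> ` ?I \<inter> {N..<N'} = {}")
        case True
        then have "v \<in> B.span (D N' \<union> act B \<sigma> ` Y)" using R 2 unfolding R_def by blast
        moreover have "act B \<sigma> ` Y \<subseteq> Z" unfolding Z_def using True 2(2) by blast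
        ultimately show ?thesis using B.span_mono[of "D N' \<union> act B \<sigma> ` Y" "D N' \<union> Z"] by blast
      next
        case False
        then have "v \<in> meeting N n W N'" unfolding meeting_def using 2 by blast
        then have "v \<in> D N'" unfolding D_def by (intro B.span_base) simp
        then show ?thesis by (intro B.span_base) simp
      qed
    qed
  qed
  then have "extension N' ?C h'" using h' extension_subset by blast
  moreover have "stable N ?C"
  proof (rule stable_span)
    show "{act B \<sigma> w | \<sigma> w. \<sigma> \<in> fixing N \<and> w \<in> W} \<subseteq> carr B" using WB B.act_closed by blast
    fix \<tau> s assume "\<tau> \<in> fixing N" "s \<in> {act B \<sigma> w | \<sigma> w. \<sigma> \<in> fixing N \<and> w \<in> W}"
    then show "act B \<tau> s \<in> {act B \<sigma> w | \<sigma> w. \<sigma> \<in> fixing N \<and> w \<in> W}"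
      using fixing_mult WB B.act_mult by (smt (verit) mem_Collect_eq)
  qed
  ultimately show ?thesis using extension_descend N' by blast
qed

text \<open>By \<open>span_symmetric\<close> the generators lie in the span of finitely many
  symmetric vectors of the same degree. The extension is made over the translates of those and then
  restricted.\<close>

lemma extension_symmetrize:
  assumes W: "finite W" "\<And>w. w \<in> W \<Longrightarrow> w \<in> carr B \<and> B.invariant (N + n) w"
    and lower: "\<And>N' T. N \<le> N' \<Longrightarrow> finite T \<Longrightarrow> (\<And>t. t \<in> T \<Longrightarrow> B.symmetric N n t) \<Longrightarrow>
      \<exists>h. extension N' (B.span (A \<union> meeting N n T N')) h"
  shows "\<exists>h. extension N (B.span (A \<union> {act B \<sigma> w | \<sigma> w. \<sigma> \<in> fixing N \<and> w \<in> W})) h"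
proof -
  have "\<forall>w\<in>W. \<exists>T. finite T \<and> (\<forall>t\<in>T. B.symmetric N n t) \<and> w \<in> B.span T"
    using W(2) B.span_symmetric by blast
  then obtain T where T: "\<And>w. w \<in> W \<Longrightarrow> finite (T w) \<and> (\<forall>t\<in>T w. B.symmetric N n t) \<and> w \<in> B.span (T w)"
    by metis
  let ?T = "\<Union>w\<in>W. T w"
  let ?S = "{act B \<sigma> t | \<sigma> t. \<sigma> \<in> fixing N \<and> t \<in> ?T}"
  have T': "finite ?T" "\<And>t. t \<in> ?T \<Longrightarrow> B.symmetric N n t"
    using W(1) T by auto
  have "\<exists>h. extension N (B.span (A \<union> ?S)) h"
    by (rule extension_symmetric[OF T'])
        (assumption, rule lower[OF _ T'])
  moreover have "B.span (A \<union> {act B \<sigma> w | \<sigma> w. \<sigma> \<in> fixing N \<and> w \<in> W}) \<subseteq> B.span (A \<union> ?S)"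
  proof (rule B.span_minimal[OF _ B.subspace_span], rule subsetI)
    fix v assume "v \<in> A \<union> {act B \<sigma> w | \<sigma> w. \<sigma> \<in> fixing N \<and> w \<in> W}"
    then consider "v \<in> A" | \<sigma> w where "v = act B \<sigma> w" "\<sigma> \<in> fixing N" "w \<in> W" by blast
    then show "v \<in> B.span (A \<union> ?S)"
    proof cases
      case 1
      then show ?thesis by (intro B.span_base) simp
    next
      case 2
      have "act B \<sigma> w \<in> B.span (A \<union> ?S)"
      proof (rule B.act_span_closed)
        show "w \<in> B.span (T w)" using T 2 by blast
        show "T w \<subseteq> carr B" using T[OF 2(3)] B.symmetric_carr by blast
        fix t assume "t \<in> T w"
        then show "act B \<sigma> t \<in> B.span (A \<union> ?S)"
          using 2 by (intro B.span_base) blast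
      qed
      then show ?thesis using 2(1) by simp
    qed
  qed
  ultimately show ?thesis using extension_subset by blast
qed

text \<open>Induction on \<open>n\<close>, with \<open>N\<close> arbitrary because each step passes
  to a larger \<open>N'\<close>: fixing more indices lowers the degree of the translates that meet
  them.\<close>

lemma extension_finitely_generated:
  assumes "finite W" "\<And>w. w \<in> W \<Longrightarrow> w \<in> carr B \<and> B.invariant (N + n) w"
  shows "\<exists>h. extension N (B.span (A \<union> {act B \<sigma> w | \<sigma> w. \<sigma> \<in> fixing N \<and> w \<in> W})) h"
  using assms
proof (induction n arbitrary: N W)
  case 0
  show ?case
  proof (rule extension_symmetrize[of _ _ 0])
    fix N' T
    \<comment> \<open>The block is empty in degree 0, so no translate meets the fixed indices and
      \<open>g\<close> itself is the extension required.\<close>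
    have "meeting N 0 T N' = {}" by (simp add: meeting_def)
    moreover have "B.span A = A" using A_subspace by simp
    moreover have "extension N' A g"
      by (simp add: extension_def g_carr g_add g_scal g_act)
    ultimately show "\<exists>h. extension N' (B.span (A \<union> meeting N 0 T N')) h" by (metis Un_empty_right)
  qed (use 0 in auto)
next
  case (Suc n)
  show ?case
  proof (rule extension_symmetrize[of _ _ "Suc n"])
    fix N' and T :: "'b set"
    assume N': "N \<le> N'" and T: "finite T" "\<And>t. t \<in> T \<Longrightarrow> B.symmetric N (Suc n) t"
    let ?I = "{N..<N + Suc n}"
    \<comment> \<open>Representatives under \<open>fixing N'\<close> of the translates to be
      covered. They are finitely many and invariant under \<open>fixing (N' + n)\<close>, hence of
      degree \<open>n\<close> relative to \<open>N'\<close>.\<close>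
    define W' where "W' = (\<Union>t\<in>T. {act B \<sigma> t | \<sigma>. \<sigma> \<in> fixing N \<and> apply \<sigma> ` ?I \<subseteq> {..<N'+n}})"
    have "finite W'"
      unfolding W'_def using T by (intro finite_UN_I B.finite_symmetric_orbit)
    moreover have "w \<in> carr B \<and> B.invariant (N' + n) w" if "w \<in> W'" for w
    proof -
      obtain \<sigma> t where w: "w = act B \<sigma> t" "t \<in> T" "\<sigma> \<in> fixing N" "apply \<sigma> ` ?I \<subseteq> {..<N'+n}"
        using \<open>w \<in> W'\<close> unfolding W'_def by blast
      note t = B.symmetric_carr[OF T(2)[OF w(2)]] B.symmetric_invariant[OF T(2)[OF w(2)]]
      have "\<sigma> \<langle>$\<rangle> i < N' + n" if "i < N + Suc n" for i
      proof (cases "i < N")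
        case True
        then show ?thesis using w(3) N' by (simp add: fixing_def)
      next
        case False
        then have "i \<in> ?I" using that by simp
        then show ?thesis using w(4) by blast
      qed
      then show ?thesis
        unfolding w(1) using t by (intro conjI B.act_closed B.invariant_act[of t "N + Suc n"]) auto
    qed
    ultimately obtain h where
      h: "extension N' (B.span (A \<union> {act B \<sigma> w | \<sigma> w. \<sigma> \<in> fixing N' \<and> w \<in> W'})) h"
      using Suc.IH by blast
    have "meeting N (Suc n) T N' \<subseteq> {act B \<sigma> w | \<sigma> w. \<sigma> \<in> fixing N' \<and> w \<in> W'}"
    proof
      fix v assume "v \<in> meeting N (Suc n) T N'"
      then obtain \<sigma> t where v: "v = act B \<sigma> t" "\<sigma> \<in> fixing N" "t \<in> T"
          "apply \<sigma> ` ?I \<inter> {N..<N'} \<noteq> {}"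
        unfolding meeting_def by blast
      \<comment> \<open>At least one of the \<open>Suc n\<close> indices lies below
        \<open>N'\<close>, so at most \<open>n\<close> remain. An element of
        \<open>fixing N'\<close> moves these into \<open>{N'..<N'+n}\<close>.\<close>
      let ?S = "apply \<sigma> ` ?I - {..<N'}"
      have "?S \<subset> apply \<sigma> ` ?I" using v(4) by auto
      then have "card ?S < card (apply \<sigma> ` ?I)" by (intro psubset_card_mono) auto
      also have "\<dots> = Suc n" by (simp add: card_image inj_on_subset[OF inj_apply])
      finally have "card ?S \<le> card {N'..<N'+n}" by simp
      then obtain e where e: "e ` ?S \<subseteq> {N'..<N'+n}" "inj_on e ?S"
        using card_le_inj[of ?S "{N'..<N'+n}"] by auto
      define f where "f i = (if i < N' then i else e i)" for i
      have "inj_on f ({..<N'} \<union> ?S)"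
      proof (rule inj_onI)
        fix i j assume ij: "i \<in> {..<N'} \<union> ?S" "j \<in> {..<N'} \<union> ?S" "f i = f j"
        have big: "N' \<le> e l" if "l \<in> ?S" for l
        proof -
          have "e l \<in> {N'..<N'+n}" using e(1) that by blast
          then show ?thesis by simp
        qed
        show "i = j"
        proof (cases "i < N' \<or> j < N'")
          case True
          then show ?thesis using ij big[of i] big[of j] by (auto simp: f_def split: if_splits)
        next
          case False
          then show ?thesis using ij e(2) by (simp add: f_def inj_on_eq_iff)
        qed
      qed
      then obtain \<tau> :: "nat perm" where \<tau>: "\<And>i. i \<in> {..<N'} \<union> ?S \<Longrightarrow> \<tau> \<langle>$\<rangle> i = f i"
        using extend_to_perm[of "{..<N'} \<union> ?S" f] by auto
      have \<tau>N': "\<tau> \<in> fixing N'" using \<tau> by (simp add: fixing_def f_def)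
      have "(\<tau> * \<sigma>) \<langle>$\<rangle> i < N' + n" if "i \<in> ?I" for i
      proof (cases "\<sigma> \<langle>$\<rangle> i < N'")
        case True
        then show ?thesis using \<tau>[of "\<sigma> \<langle>$\<rangle> i"] by (simp add: apply_times f_def)
      next
        case False
        then have S: "\<sigma> \<langle>$\<rangle> i \<in> ?S" using that by blast
        then have "e (\<sigma> \<langle>$\<rangle> i) \<in> {N'..<N'+n}" using e(1) by blast
        then show ?thesis using \<tau>[of "\<sigma> \<langle>$\<rangle> i"] S False by (simp add: apply_times f_def)
      qed
      then have "apply (\<tau> * \<sigma>) ` ?I \<subseteq> {..<N'+n}" by blast
      moreover have "\<tau> * \<sigma> \<in> fixing N" using v(2) \<tau>N' N' fixing_le fixing_mult by blast
      ultimately have "act B (\<tau> * \<sigma>) t \<in> W'" unfolding W'_def using v(3) by blast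
      moreover have "v = act B (inverse \<tau>) (act B (\<tau> * \<sigma>) t)"
        using v(1) B.symmetric_carr[OF T(2)[OF v(3)]] by (simp add: B.act_mult B.act_closed)
      moreover have "inverse \<tau> \<in> fixing N'" using \<tau>N' by simp
      ultimately show "v \<in> {act B \<sigma> w | \<sigma> w. \<sigma> \<in> fixing N' \<and> w \<in> W'}" by blast
    qed
    then have "B.span (A \<union> meeting N (Suc n) T N')
        \<subseteq> B.span (A \<union> {act B \<sigma> w | \<sigma> w. \<sigma> \<in> fixing N' \<and> w \<in> W'})"
      by (intro B.span_mono) blast
    then show "\<exists>h. extension N' (B.span (A \<union> meeting N (Suc n) T N')) h"
      using h extension_subset by blast
  qed (use Suc.prems in auto)
qed

text \<open>Smoothness places \<open>v\<close> at some finite level, so the subrepresentation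
  generated by \<open>A\<close> and \<open>v\<close> falls under the finitely generated case with
  \<open>N = 0\<close>.\<close>

lemma extension_insert:
  assumes v: "v \<in> carr B"
  shows "\<exists>C h. stable 0 C \<and> v \<in> C \<and> extension 0 C h"
proof -
  obtain n where n: "B.invariant n v"
    using B.smooth[OF v] by (auto simp: B.invariant_def)
  let ?S = "{act B \<sigma> w | \<sigma> w. \<sigma> \<in> fixing 0 \<and> w \<in> {v}}"
  have "\<exists>h. extension 0 (B.span (A \<union> ?S)) h"
    by (rule extension_finitely_generated[of _ _ n]) (use v n in auto)
  moreover have "stable 0 (B.span (A \<union> ?S))"
  proof (rule stable_span)
    show "?S \<subseteq> carr B" using v B.act_closed by blast
    fix \<tau> s assume "s \<in> ?S"
    then obtain \<sigma> where "s = act B \<sigma> v" by blast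
    then have "act B \<tau> s = act B (\<tau> * \<sigma>) v" using v by (simp add: B.act_mult)
    then show "act B \<tau> s \<in> ?S" by auto
  qed
  moreover have "v \<in> B.span (A \<union> ?S)"
  proof (rule B.span_base)
    have "v = act B 1 v" using v by (simp add: B.act_one)
    then show "v \<in> A \<union> ?S" by auto
  qed
  ultimately show ?thesis by blast
qed

section \<open>Extension to the whole representation\<close>

text \<open>Partial extensions are encoded by their graphs, so that the order is inclusion and the
  upper bound of a chain is its union.\<close>

definition graph_extension :: "('b \<times> 'm) set \<Rightarrow> bool" where
  "graph_extension G \<longleftrightarrow>
     G \<subseteq> carr B \<times> carr Q \<and>
     (\<forall>x\<in>A. (x, g x) \<in> G) \<and>
     (\<forall>x y z. (x, y) \<in> G \<longrightarrow> (x, z) \<in> G \<longrightarrow> y = z) \<and>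
     (\<forall>x y x' y'. (x, y) \<in> G \<longrightarrow> (x', y') \<in> G \<longrightarrow> (x + x', y + y') \<in> G) \<and>
     (\<forall>a x y. (x, y) \<in> G \<longrightarrow> (scal B a x, scal Q a y) \<in> G) \<and>
     (\<forall>\<sigma> x y. (x, y) \<in> G \<longrightarrow> (act B \<sigma> x, act Q \<sigma> y) \<in> G)"

lemma graph_extension_graph:
  assumes "stable 0 C" "extension 0 C h"
  shows "graph_extension ((\<lambda>x. (x, h x)) ` C)"
proof -
  have "x + y \<in> C" "scal B a x \<in> C" "act B \<sigma> x \<in> C" if "x \<in> C" "y \<in> C" for x y a \<sigma>
    using assms(1) that by (auto simp: stable_def B.subspace_add B.subspace_scale)
  then show ?thesis
    using assms unfolding graph_extension_def extension_def stable_def by (auto simp: image_iff)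
qed

lemma extension_maximal: "\<exists>h. extension 0 (carr B) h"
proof -
  have "graph_extension ((\<lambda>x. (x, g x)) ` A)"
    by (rule graph_extension_graph)
      (auto simp: stable_def extension_def A_subspace A_act g_carr g_add g_scal g_act dest: subsetD[OF A_carr])
  then have "\<exists>G\<in>Collect graph_extension. \<forall>G'\<in>Collect graph_extension. G \<subseteq> G' \<longrightarrow> G' = G"
  proof (intro subset_Zorn_nonempty)
    fix \<C> assume ne: "\<C> \<noteq> {}" and chain: "subset.chain (Collect graph_extension) \<C>"
    have mem: "graph_extension G" if "G \<in> \<C>" for G
      using chain that by (auto simp: subset.chain_def)
    have two: "\<exists>G\<in>\<C>. p \<in> G \<and> q \<in> G" if "p \<in> \<Union>\<C>" "q \<in> \<Union>\<C>" for p q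
    proof -
      from that obtain G G' where G: "G \<in> \<C>" "G' \<in> \<C>" "p \<in> G" "q \<in> G'" by blast
      then have "G \<subseteq> G' \<or> G' \<subseteq> G" using chain unfolding subset.chain_def by blast
      then show ?thesis using G by blast
    qed
    show "\<Union>\<C> \<in> Collect graph_extension"
      unfolding graph_extension_def mem_Collect_eq
    proof (intro conjI allI impI ballI)
      show "\<Union>\<C> \<subseteq> carr B \<times> carr Q"
        using mem unfolding graph_extension_def by (meson Sup_least)
    next
      fix x assume "x \<in> A"
      moreover obtain G where G: "G \<in> \<C>" using ne by blast
      ultimately have "(x, g x) \<in> G" using mem[OF G] by (simp add: graph_extension_def)
      then show "(x, g x) \<in> \<Union>\<C>" using G by blast
    next
      fix x y z assume "(x, y) \<in> \<Union>\<C>" "(x, z) \<in> \<Union>\<C>"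
      then obtain G where "G \<in> \<C>" "(x, y) \<in> G" "(x, z) \<in> G" using two by blast
      then show "y = z" using mem[of G] unfolding graph_extension_def by blast
    next
      fix x y x' y' assume "(x, y) \<in> \<Union>\<C>" "(x', y') \<in> \<Union>\<C>"
      then obtain G where G: "G \<in> \<C>" "(x, y) \<in> G" "(x', y') \<in> G"
        using two[of "(x, y)" "(x', y')"] by blast
      then have "(x + x', y + y') \<in> G" using mem[OF G(1)] by (simp add: graph_extension_def)
      then show "(x + x', y + y') \<in> \<Union>\<C>" using G(1) by blast
    next
      fix a x y assume "(x, y) \<in> \<Union>\<C>"
      then obtain G where G: "G \<in> \<C>" "(x, y) \<in> G" by blast
      then have "(scal B a x, scal Q a y) \<in> G" using mem[OF G(1)] by (simp add: graph_extension_def)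
      then show "(scal B a x, scal Q a y) \<in> \<Union>\<C>" using G(1) by blast
    next
      fix \<sigma> x y assume "(x, y) \<in> \<Union>\<C>"
      then obtain G where G: "G \<in> \<C>" "(x, y) \<in> G" by blast
      then have "(act B \<sigma> x, act Q \<sigma> y) \<in> G" using mem[OF G(1)] by (simp add: graph_extension_def)
      then show "(act B \<sigma> x, act Q \<sigma> y) \<in> \<Union>\<C>" using G(1) by blast
    qed
  qed auto
  then obtain G where G: "graph_extension G" and max: "\<And>G'. graph_extension G' \<Longrightarrow> G \<subseteq> G' \<Longrightarrow> G' = G"
    by blast
  define C where "C = Domain G"
  define h where "h x = (THE y. (x, y) \<in> G)" for x
  have G_carr: "G \<subseteq> carr B \<times> carr Q"
    and G_A: "\<And>x. x \<in> A \<Longrightarrow> (x, g x) \<in> G"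
    and G_fun: "\<And>x y z. (x, y) \<in> G \<Longrightarrow> (x, z) \<in> G \<Longrightarrow> y = z"
    and G_add: "\<And>x y x' y'. (x, y) \<in> G \<Longrightarrow> (x', y') \<in> G \<Longrightarrow> (x + x', y + y') \<in> G"
    and G_scal: "\<And>a x y. (x, y) \<in> G \<Longrightarrow> (scal B a x, scal Q a y) \<in> G"
    and G_act: "\<And>\<sigma> x y. (x, y) \<in> G \<Longrightarrow> (act B \<sigma> x, act Q \<sigma> y) \<in> G"
    using G by (simp_all add: graph_extension_def)
  have h: "h x = y" if "(x, y) \<in> G" for x y
    unfolding h_def by (rule the_equality, rule that) (rule G_fun[OF _ that])
  have hG: "(x, h x) \<in> G" if "x \<in> C" for x using that h unfolding C_def by blast
  have sub: "B.subspace C"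
    unfolding B.subspace_def
  proof (intro conjI ballI allI)
    show "0 \<in> C" using G_A[OF B.subspace_0[OF A_subspace]] unfolding C_def by blast
  next
    fix x y assume "x \<in> C" "y \<in> C"
    then show "x + y \<in> C" using G_add[OF hG hG] unfolding C_def by blast
  next
    fix a x assume "x \<in> C"
    then show "scal B a x \<in> C" using G_scal[OF hG] unfolding C_def by blast
  qed
  have CB: "C \<subseteq> carr B" using G_carr unfolding C_def by blast
  have AC: "A \<subseteq> C" using G_A unfolding C_def by blast
  have C_act: "act B \<sigma> x \<in> C" if "x \<in> C" for \<sigma> x using G_act[OF hG[OF that]] unfolding C_def by blast
  have hQ: "h x \<in> carr Q" if "x \<in> C" for x using hG[OF that] G_carr by blast
  have "extension 0 C h"
    unfolding extension_def
    using hG hQ G_add G_scal G_act G_A by (auto intro!: h)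
  \<comment> \<open>The maximal domain takes the place of \<open>A\<close>, so that one more vector
    can be adjoined to it.\<close>
  interpret C: extension_problem B Q C h \<pi>
  proof
    show "contraction Q \<pi>" by (rule contraction)
  qed (use sub CB C_act \<open>extension 0 C h\<close> in \<open>auto simp: extension_def\<close>)
  have "carr B \<subseteq> C"
  proof
    fix v assume "v \<in> carr B"
    then obtain C' h' where C': "C.stable 0 C'" "v \<in> C'" "C.extension 0 C' h'"
      using C.extension_insert by blast
    have "stable 0 C'" "extension 0 C' h'"
      using C' AC \<open>extension 0 C h\<close>
      unfolding stable_def extension_def C.stable_def C.extension_def by auto
    then have "graph_extension ((\<lambda>x. (x, h' x)) ` C')" by (rule graph_extension_graph)
    moreover have "G \<subseteq> (\<lambda>x. (x, h' x)) ` C'"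
    proof clarify
      fix x y assume xy: "(x, y) \<in> G"
      then have "x \<in> C" unfolding C_def by blast
      then have "x \<in> C'" "h' x = y"
        using C' h[OF xy] unfolding C.stable_def C.extension_def by auto
      then show "(x, y) \<in> (\<lambda>x. (x, h' x)) ` C'" by auto
    qed
    ultimately have "(\<lambda>x. (x, h' x)) ` C' = G" by (rule max)
    then show "v \<in> C" using C'(2) unfolding C_def by blast
  qed
  then have "C = carr B" using CB by blast
  with \<open>extension 0 C h\<close> show ?thesis by blast
qed

end

section \<open>Injectivity from contractions\<close>

lemma injective_object_contraction:
  fixes Q :: "('k::field, 'm::ab_group_add) semirep"
  assumes Q: "smooth_rep Q" and \<pi>: "contraction Q \<pi>"
  shows "injective_object TYPE('a::ab_group_add) TYPE('b::ab_group_add) Q"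
  unfolding injective_object_def
proof (intro conjI allI impI)
  fix A :: "('k, 'a) semirep" and B :: "('k, 'b) semirep" and f g
  assume A: "smooth_rep A" and B: "smooth_rep B" and mono: "monomorphism A B f" and g: "morphism A Q g"
  interpret A: smooth_rep A by fact
  interpret B: smooth_rep B by fact
  interpret Q: smooth_rep Q by fact
  have f: "morphism A B f" and inj: "inj_on f (carr A)"
    using mono monomorphism_iff_inj[OF A B] by auto
  \<comment> \<open>\<open>A\<close> is replaced by its image under \<open>f\<close>, which makes
    the problem one about a subrepresentation of \<open>B\<close>.\<close>
  define g' where "g' = g \<circ> the_inv_into (carr A) f"
  have g': "g' (f x) = g x" if "x \<in> carr A" for x
    using the_inv_into_f_f[OF inj that] by (simp add: g'_def)
  have f_image: "f x + f y \<in> f ` carr A" "scal B a (f x) \<in> f ` carr A" "act B \<sigma> (f x) \<in> f ` carr A"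
    if "x \<in> carr A" "y \<in> carr A" for x y a \<sigma>
    using f that A.subspace_carr A.act_closed unfolding morphism_def A.subspace_def by (metis image_eqI)+
  have g_f: "g' (f x + f y) = g' (f x) + g' (f y)" "g' (scal B a (f x)) = scal Q a (g' (f x))"
      "g' (act B \<sigma> (f x)) = act Q \<sigma> (g' (f x))"
    if "x \<in> carr A" "y \<in> carr A" for x y a \<sigma>
    using f g g' that A.subspace_carr A.act_closed unfolding morphism_def A.subspace_def by metis+
  interpret extension_problem B Q "f ` carr A" g' \<pi>
  proof
    show "B.subspace (f ` carr A)"
      unfolding B.subspace_def using f_image morphism_zero[OF A B f] A.zero_carr by (auto simp: image_iff)
    show "f ` carr A \<subseteq> carr B" using f by (auto simp: morphism_def)
    show "g' x \<in> carr Q" if "x \<in> f ` carr A" for x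
      using that g g' by (auto simp: morphism_def)
  qed (use f_image g_f \<pi> in auto)
  obtain h where "extension 0 (carr B) h" using extension_maximal by blast
  then have "morphism B Q h" "\<forall>x\<in>carr A. h (f x) = g x"
    using g' by (auto simp: extension_def morphism_def)
  then show "\<exists>h. morphism B Q h \<and> (\<forall>x\<in>carr A. h (f x) = g x)" by blast
qed (rule Q)

lemma morphism_compose:
  "morphism A B f \<Longrightarrow> morphism B C g \<Longrightarrow> morphism A C (g \<circ> f)"
  by (simp add: morphism_def)

text \<open>A map into \<open>Q\<close> is carried to \<open>R\<close>, extended there and carried
  back.\<close>

lemma injective_object_isomorphic:
  fixes Q :: "('k::field, 'm::ab_group_add) semirep" and R :: "('k, 'n::ab_group_add) semirep"
  assumes Q: "smooth_rep Q" and R: "injective_object TYPE('a::ab_group_add) TYPE('b::ab_group_add) R"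
    and iso: "isomorphic Q R"
  shows "injective_object TYPE('a) TYPE('b) Q"
  unfolding injective_object_def
proof (intro conjI allI impI)
  fix A :: "('k, 'a) semirep" and B :: "('k, 'b) semirep" and f g
  assume *: "smooth_rep A" "smooth_rep B" "monomorphism A B f" and g: "morphism A Q g"
  obtain \<phi> \<psi> where \<phi>: "morphism Q R \<phi>" "morphism R Q \<psi>" "\<forall>x\<in>carr Q. \<psi> (\<phi> x) = x"
    using iso unfolding isomorphic_def by blast
  obtain h where h: "morphism B R h" "\<forall>x\<in>carr A. h (f x) = (\<phi> \<circ> g) x"
    using R * morphism_compose[OF g \<phi>(1)] unfolding injective_object_def by metis
  have "morphism B Q (\<psi> \<circ> h)" using h(1) \<phi>(2) by (rule morphism_compose)
  moreover have "(\<psi> \<circ> h) (f x) = g x" if "x \<in> carr A" for x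
    using that h(2) \<phi>(3) g by (simp add: morphism_def)
  ultimately show "\<exists>h. morphism B Q h \<and> (\<forall>x\<in>carr A. h (f x) = g x)" by blast
qed (rule Q)

theorem theorem4p10:
  fixes M :: "('k::field, 'm::ab_group_add) semirep"
  assumes "standard TYPE('i) M"
  shows "injective_object TYPE('a::ab_group_add) TYPE('b::ab_group_add) M"
proof -
  obtain J :: "'i set" and r :: "'i \<Rightarrow> nat"
    where M: "smooth_rep M" and iso: "isomorphic M (direct_sum J (\<lambda>i. subset_rep (r i)))"
    using assms unfolding standard_def by blast
  have "injective_object TYPE('a) TYPE('b) (direct_sum J (\<lambda>i. subset_rep (r i)) :: ('k, _) semirep)"
    by (rule injective_object_contraction)
      (rule smooth_rep_direct_sum contraction_direct_sum smooth_rep_subset_rep contraction_subset_rep)+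
  with M show ?thesis using iso by (rule injective_object_isomorphic)
qed

end
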